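(* There exists a constant $C > 0$ and an infinite sequence $\{\alpha_t\}_{t \in \mathbb{N}}$ in $(0,1)$ with $\alpha_t \rightarrow 0$ such that for all $\alpha = \alpha_t$ and all $r\in\mathbb{N}$ with $\frac{C}{\alpha^2} \leq r \leq O\left( \frac{1}{\alpha^4} \right)$, we have $N^{\mathbb{R}}_\alpha(r) = \Theta(1/\alpha^4)$. That is, for every constant $c>0$ there exist constants $c_1,c_2>0$ and $t_0 \in \mathbb{N}$ such that for all $t \geq t_0$ and all $r\in\mathbb{N}$ with $C/\alpha_t^2 \leq r \leq c/\alpha_t^4$, \[ \frac{c_1}{\alpha_t^4} \leq N^{\mathbb{R}}_{\alpha_t}(r) \leq \frac{c_2}{\alpha_t^4}. \]
   Context: $\mathbb{N}$ is the set of positive integers. Lines $l_1,\dots,l_n$ through the origin in $\mathbb{R}^r$ are equiangular with common angle $\arccos(\alpha)$ if, choosing a unit vector $v_i$ along each $l_i$, one has $|\langle v_i, v_j\rangle| = \alpha$ for all $i \neq j$. $N^{\mathbb{R}}_\alpha(r)$ denotes the maximum number of equiangular lines in $\mathbb{R}^r$ with common angle $\arccos(\alpha)$. *)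

theory Defs
  imports Complex_Main "Jordan_Normal_Form.Matrix"
begin

definition lines_through_origin :: "nat \<Rightarrow> real vec set set" where
  "lines_through_origin r =
     {l. \<exists>v \<in> carrier_vec r. v \<noteq> 0\<^sub>v r \<and> l = {c \<cdot>\<^sub>v v | c. True}}"

text \<open>The unit vectors on a line are determined up to sign, so the condition below does not
  depend on the choice function \<open>v\<close>.\<close>

definition equiangular :: "nat \<Rightarrow> real \<Rightarrow> real vec set set \<Rightarrow> bool" where
  "equiangular r \<alpha> L \<longleftrightarrow>
     L \<subseteq> lines_through_origin r \<and>
     (\<exists>v. (\<forall>l\<in>L. v l \<in> l \<and> v l \<bullet> v l = 1) \<and>
          (\<forall>l\<in>L. \<forall>m\<in>L. l \<noteq> m \<longrightarrow> \<bar>v l \<bullet> v m\<bar> = \<alpha>))"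

text \<open>For \<open>0 \<le> \<alpha> < 1\<close> the cardinalities are bounded by \<open>r * (r + 1) div 2\<close>, so
  the maximum is attained, and every equiangular family is finite.\<close>

definition max_equiangular :: "real \<Rightarrow> nat \<Rightarrow> nat" where
  "max_equiangular \<alpha> r = Max {card L | L. finite L \<and> equiangular r \<alpha> L}"

end

theory Submission
  imports
    Defs
    "HOL-Analysis.Convex"
    "HOL-Algebra.Algebraic_Closure_Type"
    "HOL-Library.Product_Plus"
    "HOL-Library.Z2"
begin

text \<open>Upper bound. For \<open>i \<in> I\<close> the matrices \<open>v i (v i)\<^sup>T\<close> have constant pairwise Frobenius
  products \<open>\<alpha>\<^sup>2\<close>, so projecting \<open>u w\<^sup>T\<close> onto their centred span bounds the variance of
  \<open>i \<mapsto> \<langle>u, v i\<rangle> \<langle>w, v i\<rangle>\<close> by \<open>\<parallel>u\<parallel>\<^sup>2 \<parallel>w\<parallel>\<^sup>2\<close>. If there are many more than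
  \<open>\<alpha>\<^sup>-\<^sup>4\<close> lines, this lets one switch signs, and drop at most half of the lines, so that the graph of
  negative inner products has maximum degree at most \<open>\<alpha>\<^sup>-\<^sup>4\<close>. Then the centroid \<open>w\<close> has squared norm
  about \<open>\<alpha>\<close>, and using it in the same inequality improves the degree to \<open>O(\<alpha>\<^sup>-\<^sup>3)\<close>; the
  Cauchy-Schwarz inequality for a vector and the sum of its centred neighbours improves this to
  \<open>O(\<alpha>\<^sup>-\<^sup>2)\<close>. The centred Gram matrix is therefore nearly the identity, and since its rank is at
  most \<open>r\<close>, there are only \<open>O(r)\<close> lines.

  Lower bound. A Kerdock set of \<open>2\<^sup>m\<close> quadratic forms on \<open>V = GF(2\<^sup>m) \<times> GF(2)\<close>, \<open>m\<close> odd,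
  with nondegenerate differences gives \<open>2\<^sup>m\<close> mutually unbiased bases of a space of dimension
  \<open>D\<^sup>2 = 2\<^sup>m\<^sup>+\<^sup>1\<close>. Adding to each vector of the \<open>s\<close>-th basis a multiple of a new unit vector
  indexed by \<open>s\<close> turns the inner products \<open>0\<close> inside a basis into the common absolute value,
  which after normalisation is \<open>1 / (D + 1)\<close>.\<close>

unbundle no inner_syntax

section \<open>Upper bound by matrix projection\<close>

text \<open>Vectors are functions of which only the coordinates below \<open>r\<close> count, so
  sums, switched and centred vectors are plain lambda terms without dimension conditions.\<close>

definition dot :: "nat \<Rightarrow> (nat \<Rightarrow> real) \<Rightarrow> (nat \<Rightarrow> real) \<Rightarrow> real" where
  "dot r u w = (\<Sum>k<r. u k * w k)"

lemma dot_commute: "dot r u w = dot r w u"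
  by (simp add: dot_def mult.commute)

lemma dot_sum_left: "dot r (\<lambda>k. \<Sum>i\<in>I. f i k) w = (\<Sum>i\<in>I. dot r (f i) w)"
  unfolding dot_def by (subst sum.swap) (simp add: sum_distrib_right)

lemma dot_sum_right: "dot r w (\<lambda>k. \<Sum>i\<in>I. f i k) = (\<Sum>i\<in>I. dot r w (f i))"
  unfolding dot_def by (subst sum.swap) (simp add: sum_distrib_left)

lemma dot_scale_left: "dot r (\<lambda>k. c * u k) w = c * dot r u w"
  by (simp add: dot_def sum_distrib_left mult.assoc)

lemma dot_scale_right: "dot r u (\<lambda>k. c * w k) = c * dot r u w"
  by (simp add: dot_def sum_distrib_left mult.left_commute)

lemma dot_diff_left: "dot r (\<lambda>k. u k - u' k) w = dot r u w - dot r u' w"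
  by (simp add: dot_def sum_subtractf left_diff_distrib)

lemma dot_diff_right: "dot r w (\<lambda>k. u k - u' k) = dot r w u - dot r w u'"
  by (simp add: dot_def sum_subtractf right_diff_distrib)

lemmas dot_linear = dot_sum_left dot_sum_right dot_scale_left dot_scale_right
  dot_diff_left dot_diff_right

lemma dot_self_nonneg: "0 \<le> dot r u u"
  by (simp add: dot_def sum_nonneg)

lemma dot_Cauchy_Schwarz: "(dot r u w)\<^sup>2 \<le> dot r u u * dot r w w"
  using Cauchy_Schwarz_ineq_sum[of u w "{..<r}"] by (simp add: dot_def power2_eq_square)

lemma sum_mult_Times:
  fixes f :: "'a \<Rightarrow> 'c::comm_semiring_0"
  shows "(\<Sum>p\<in>A \<times> B. f (fst p) * g (snd p)) = sum f A * sum g B"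
  by (simp add: sum_product sum.cartesian_product case_prod_beta)

section \<open>Frobenius norms of sums of rank-one matrices\<close>

text \<open>The left side is the squared Frobenius norm of the matrix with entries
  \<open>\<Sum>i\<in>I. c i * v i a * v i b\<close>; the Frobenius product of two rank-one
  projections is the square of the inner product of their vectors.\<close>

lemma sum_Frobenius:
  "(\<Sum>(a,b)\<in>{..<r}\<times>{..<r}. (\<Sum>i\<in>I. c i * v i a * v i b)\<^sup>2) =
   (\<Sum>i\<in>I. \<Sum>j\<in>I. c i * c j * (dot r (v i) (v j))\<^sup>2)"
proof -
  have "(\<Sum>(a,b)\<in>{..<r}\<times>{..<r}. (\<Sum>i\<in>I. c i * v i a * v i b)\<^sup>2) =
        (\<Sum>p\<in>{..<r}\<times>{..<r}. \<Sum>i\<in>I. \<Sum>j\<in>I.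
           c i * c j * ((v i (fst p) * v j (fst p)) * (v i (snd p) * v j (snd p))))"
    by (simp add: case_prod_beta power2_eq_square sum_product mult_ac)
  also have "\<dots> = (\<Sum>i\<in>I. \<Sum>j\<in>I. \<Sum>p\<in>{..<r}\<times>{..<r}.
           c i * c j * ((v i (fst p) * v j (fst p)) * (v i (snd p) * v j (snd p))))"
    by (subst sum.swap, rule sum.cong[OF refl], subst sum.swap, rule refl)
  also have "\<dots> = (\<Sum>i\<in>I. \<Sum>j\<in>I. c i * c j * (dot r (v i) (v j))\<^sup>2)"
    by (simp add: dot_def power2_eq_square flip: sum_distrib_left)
      (simp add: sum_mult_Times[of "\<lambda>k. v i k * v j k" "\<lambda>k. v i k * v j k" for i j])
  finally show ?thesis .
qed

text \<open>Only \<open>r\<close> diagonal entries contribute to the trace of \<open>Y\<close>, so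
  Cauchy-Schwarz bounds its square by \<open>r\<close> times the squared Frobenius norm. Through
  this inequality the dimension enters the upper bound.\<close>

lemma trace_squared_le:
  "(\<Sum>i\<in>I. dot r (u i) (u i))\<^sup>2 \<le> real r * (\<Sum>i\<in>I. \<Sum>j\<in>I. (dot r (u i) (u j))\<^sup>2)"
proof -
  define Y where "Y = (\<lambda>a b. \<Sum>i\<in>I. 1 * u i a * u i b)"
  have "(\<Sum>i\<in>I. dot r (u i) (u i)) = (\<Sum>a<r. Y a a)"
    unfolding dot_def Y_def by (subst sum.swap) simp
  then have "(\<Sum>i\<in>I. dot r (u i) (u i))\<^sup>2 \<le> real r * (\<Sum>a<r. (Y a a)\<^sup>2)"
    using sum_squared_le_sum_of_squares[of "\<lambda>a. Y a a" "{..<r}"] by (simp add: mult.commute)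
  also have "(\<Sum>a<r. (Y a a)\<^sup>2) \<le> (\<Sum>a<r. \<Sum>b<r. (Y a b)\<^sup>2)"
  proof (rule sum_mono)
    fix a assume "a \<in> {..<r}"
    then show "(Y a a)\<^sup>2 \<le> (\<Sum>b<r. (Y a b)\<^sup>2)"
      by (intro member_le_sum) auto
  qed
  also have "\<dots> = (\<Sum>i\<in>I. \<Sum>j\<in>I. (dot r (u i) (u j))\<^sup>2)"
    using sum_Frobenius[where r = r and c = "\<lambda>_. 1" and v = u and I = I] by (simp add: Y_def sum.cartesian_product)
  finally show ?thesis by (simp add: mult_left_mono)
qed

section \<open>Equiangular unit vectors and the variance inequality\<close>

locale equiangular_vectors =
  fixes r :: nat and \<alpha> :: real and I :: "'a set" and v :: "'a \<Rightarrow> nat \<Rightarrow> real"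
  assumes fin: "finite I"
    and alpha_pos: "0 < \<alpha>" and alpha_le: "\<alpha> \<le> 1 / 4"
    and unit: "i \<in> I \<Longrightarrow> dot r (v i) (v i) = 1"
    and angle: "i \<in> I \<Longrightarrow> j \<in> I \<Longrightarrow> i \<noteq> j \<Longrightarrow> \<bar>dot r (v i) (v j)\<bar> = \<alpha>"
begin

lemma subfamily: "J \<subseteq> I \<Longrightarrow> equiangular_vectors r \<alpha> J v"
  using fin alpha_pos alpha_le unit angle
  by unfold_locales (auto simp: subset_iff intro: finite_subset)

lemma dot_squared:
  assumes "i \<in> I" "j \<in> I"
  shows "(dot r (v i) (v j))\<^sup>2 = (if i = j then 1 else \<alpha>\<^sup>2)"
  using assms unit[of i] angle[of i j] by (metis power2_abs power_one)

text \<open>Cauchy-Schwarz for the Frobenius product of the rank-one matrix of \<open>u\<close> and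
  \<open>w\<close> with \<open>Y\<close>. Because all off-diagonal squared inner products equal
  \<open>\<alpha>\<^sup>2\<close>, the squared norm of \<open>Y\<close> is
  \<open>\<alpha>\<^sup>2\<close> times the square of \<open>sum c I\<close>, which vanishes, plus a
  diagonal part.\<close>

lemma centred_projection:
  assumes "sum c I = 0"
  shows "(\<Sum>i\<in>I. c i * (dot r u (v i) * dot r w (v i)))\<^sup>2
           \<le> dot r u u * dot r w w * (\<Sum>i\<in>I. (c i)\<^sup>2)"
proof -
  define Y where "Y = (\<lambda>p. \<Sum>i\<in>I. c i * v i (fst p) * v i (snd p))"
  define P where "P = {..<r} \<times> {..<r}"
  have "(\<Sum>i\<in>I. c i * (dot r u (v i) * dot r w (v i))) =
        (\<Sum>i\<in>I. \<Sum>p\<in>P. c i * ((u (fst p) * v i (fst p)) * (w (snd p) * v i (snd p))))"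
    unfolding P_def sum_distrib_left[symmetric]
      sum_mult_Times[of "\<lambda>k. u k * v i k" "\<lambda>k. w k * v i k" for i]
    by (simp add: dot_def)
  also have "\<dots> = (\<Sum>p\<in>P. (u (fst p) * w (snd p)) * Y p)"
    by (subst sum.swap) (simp add: Y_def sum_distrib_left mult_ac)
  finally have "(\<Sum>i\<in>I. c i * (dot r u (v i) * dot r w (v i)))\<^sup>2 \<le>
      (\<Sum>p\<in>P. (u (fst p) * w (snd p))\<^sup>2) * (\<Sum>p\<in>P. (Y p)\<^sup>2)"
    by (simp only: Cauchy_Schwarz_ineq_sum)
  also have "(\<Sum>p\<in>P. (u (fst p) * w (snd p))\<^sup>2) = dot r u u * dot r w w"
    using sum_mult_Times[of "\<lambda>k. u k * u k" "\<lambda>k. w k * w k" "{..<r}" "{..<r}"]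
    by (simp add: dot_def P_def power2_eq_square mult_ac)
  also have "(\<Sum>p\<in>P. (Y p)\<^sup>2) = (\<Sum>i\<in>I. \<Sum>j\<in>I. c i * c j * (dot r (v i) (v j))\<^sup>2)"
    using sum_Frobenius[where r = r and c = c and v = v and I = I] by (simp add: Y_def P_def case_prod_beta)
  also have "\<dots> = (\<Sum>i\<in>I. \<Sum>j\<in>I. \<alpha>\<^sup>2 * (c i * c j) + (if i = j then (1 - \<alpha>\<^sup>2) * (c i)\<^sup>2 else 0))"
  proof (intro sum.cong refl)
    fix i j assume "i \<in> I" "j \<in> I"
    then show "c i * c j * (dot r (v i) (v j))\<^sup>2 =
        \<alpha>\<^sup>2 * (c i * c j) + (if i = j then (1 - \<alpha>\<^sup>2) * (c i)\<^sup>2 else 0)"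
      using dot_squared[of i j] by (auto simp: power2_eq_square algebra_simps)
  qed
  also have "\<dots> = \<alpha>\<^sup>2 * (sum c I * sum c I) + (1 - \<alpha>\<^sup>2) * (\<Sum>i\<in>I. (c i)\<^sup>2)"
    unfolding sum_product sum.distrib using fin by (simp add: sum_distrib_left)
  also have "\<dots> \<le> (\<Sum>i\<in>I. (c i)\<^sup>2)"
    using assms sum_nonneg[of I "\<lambda>i. (c i)\<^sup>2"] by (simp add: left_diff_distrib)
  finally show ?thesis
    by (simp add: mult_left_mono dot_self_nonneg)
qed

text \<open>The products have variance sum at most \<open>dot r u u * dot r w w\<close>. Their mean
  lies on one side of 0, so every product of the opposite sign is at least \<open>\<beta>\<close>
  away from it, and there can be only few of these.\<close>

lemma sign_dichotomy:
  fixes \<beta> :: real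
  assumes "0 \<le> \<beta>" "P \<subseteq> I"
    and neg: "\<And>i. i \<in> P \<Longrightarrow> dot r u (v i) * dot r w (v i) \<le> - \<beta>"
    and pos: "\<And>i. i \<in> I - P \<Longrightarrow> \<beta> \<le> dot r u (v i) * dot r w (v i)"
  shows "card P * \<beta>\<^sup>2 \<le> dot r u u * dot r w w \<or> card (I - P) * \<beta>\<^sup>2 \<le> dot r u u * dot r w w"
proof (cases "I = {}")
  case True
  with assms show ?thesis by (simp add: dot_self_nonneg)
next
  case False
  define b where "b = (\<lambda>i. dot r u (v i) * dot r w (v i))"
  define \<mu> where "\<mu> = sum b I / card I"
  define V where "V = (\<Sum>i\<in>I. (b i - \<mu>)\<^sup>2)"
  have n0: "card I \<noteq> 0" using False fin by simp
  have cen: "(\<Sum>i\<in>I. b i - \<mu>) = 0"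
    using n0 fin by (simp add: sum_subtractf \<mu>_def)
  have "V = (\<Sum>i\<in>I. (b i - \<mu>) * b i - \<mu> * (b i - \<mu>))"
    unfolding V_def by (intro sum.cong) (auto simp: power2_eq_square algebra_simps)
  also have "\<dots> = (\<Sum>i\<in>I. (b i - \<mu>) * b i)"
    unfolding sum_subtractf sum_distrib_left[symmetric] using cen by (simp add: sum_subtractf)
  \<comment> \<open>Centring is applied with the coefficients \<open>b i - \<mu>\<close>, for which
    both the pairing with \<open>b\<close> and the sum of squares equal \<open>V\<close>; one factor
    \<open>V\<close> then cancels.\<close>
  finally have "V\<^sup>2 \<le> dot r u u * dot r w w * V"
    using centred_projection[OF cen, of u w] by (simp add: V_def b_def)
  moreover have "0 \<le> V" by (simp add: V_def sum_nonneg)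
  ultimately have V: "V \<le> dot r u u * dot r w w"
    by (cases "V = 0") (auto simp: power2_eq_square dot_self_nonneg intro: mult_right_le_imp_le)
  have sub: "card S * \<beta>\<^sup>2 \<le> V" if "S \<subseteq> I" "\<And>i. i \<in> S \<Longrightarrow> \<beta> \<le> \<bar>b i - \<mu>\<bar>" for S
  proof -
    have "card S * \<beta>\<^sup>2 \<le> (\<Sum>i\<in>S. (b i - \<mu>)\<^sup>2)"
      using that assms(1) by (intro sum_bounded_below) (metis abs_le_square_iff abs_of_nonneg)
    also have "\<dots> \<le> V"
      unfolding V_def using that fin by (intro sum_mono2) auto
    finally show ?thesis .
  qed
  show ?thesis
  proof (cases "0 \<le> \<mu>")
    case True
    have "\<beta> \<le> \<bar>b i - \<mu>\<bar>" if "i \<in> P" for i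
      using neg[OF that] True by (simp add: b_def)
    with sub[of P] assms(2) have "card P * \<beta>\<^sup>2 \<le> V" by blast
    with V show ?thesis by linarith
  next
    case False
    have "\<beta> \<le> \<bar>b i - \<mu>\<bar>" if "i \<in> I - P" for i
      using pos[OF that] False by (simp add: b_def)
    with sub[of "I - P"] have "card (I - P) * \<beta>\<^sup>2 \<le> V" by blast
    with V show ?thesis by linarith
  qed
qed

section \<open>The graph of negative inner products and the centroid\<close>

definition negs :: "'a \<Rightarrow> 'a set" where
  "negs x = {i \<in> I. i \<noteq> x \<and> dot r (v x) (v i) < 0}"

definition centroid :: "nat \<Rightarrow> real" where
  "centroid = (\<lambda>k. 1 / card I * (\<Sum>i\<in>I. v i k))"

lemma negs_subset: "negs x \<subseteq> I - {x}"
  by (auto simp: negs_def)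

lemma finite_negs [simp]: "finite (negs x)"
  using negs_subset fin by (meson finite_Diff finite_subset)

text \<open>Separate indicators in place of nested cases let a sum over \<open>i\<close> split into
  three counts.\<close>

lemma dot_eq:
  assumes "x \<in> I" "i \<in> I"
  shows "dot r (v x) (v i) =
    (if i = x then 1 else 0) + (if i \<in> I - {x} then \<alpha> else 0) - (if i \<in> negs x then 2 * \<alpha> else 0)"
  using assms unit[of x] angle[of x i] by (auto simp: negs_def)

lemma dot_negs:
  assumes "x \<in> I" "i \<in> negs x"
  shows "i \<in> I" "dot r (v x) (v i) = - \<alpha>"
  using assms angle[of x i] by (auto simp: negs_def)

lemma row_sum:
  assumes "x \<in> I"
  shows "(\<Sum>i\<in>I. dot r (v x) (v i)) = 1 + \<alpha> * (real (card I) - 1) - 2 * \<alpha> * card (negs x)"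
proof -
  have "card I \<ge> 1" using assms fin by (simp add: Suc_le_eq card_gt_0_iff) blast
  moreover have "I \<inter> negs x = negs x" using negs_subset by blast
  moreover have "(\<Sum>i\<in>I. dot r (v x) (v i)) = (\<Sum>i\<in>I. (if i = x then 1 else 0) +
      (if i \<in> I - {x} then \<alpha> else 0) - (if i \<in> negs x then 2 * \<alpha> else 0))"
    using assms by (intro sum.cong refl dot_eq)
  ultimately show ?thesis
    using assms fin by (simp add: sum.distrib sum_subtractf sum.If_cases Int_Diff Int_absorb1
        of_nat_diff card_Diff_singleton flip: sum.inter_restrict del: Diff_iff)
qed

lemma dot_centroid:
  assumes "x \<in> I"
  shows "card I * dot r centroid (v x) = 1 + \<alpha> * (real (card I) - 1) - 2 * \<alpha> * card (negs x)"
proof -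
  have "card I \<noteq> 0" using assms fin by auto
  moreover have "dot r centroid (v x) = 1 / card I * (\<Sum>i\<in>I. dot r (v i) (v x))"
    by (simp only: centroid_def dot_linear)
  ultimately show ?thesis
    unfolding row_sum[OF assms, symmetric] by (simp add: dot_commute[of r "v x"])
qed

lemma dot_centroid_self: "card I * dot r centroid centroid = (\<Sum>i\<in>I. dot r centroid (v i))"
proof (cases "I = {}")
  case False
  then have "card I \<noteq> 0" using fin by simp
  moreover have "dot r centroid centroid = 1 / card I * (\<Sum>i\<in>I. dot r (v i) centroid)"
    by (subst (1) centroid_def) (simp only: dot_linear)
  ultimately show ?thesis by (simp add: dot_commute)
qed simp

text \<open>A row of the Gram matrix with at most \<open>D\<close> negative entries has average
  close to \<open>\<alpha>\<close>. The squared norm of the centroid is the average of its products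
  with the family, so it obeys the same bounds.\<close>

lemma centroid_bounds:
  fixes D :: real
  assumes D: "\<And>x. x \<in> I \<Longrightarrow> card (negs x) \<le> D"
  shows "x \<in> I \<Longrightarrow> \<alpha> - 2 * \<alpha> * D / card I \<le> dot r centroid (v x)"
    and "x \<in> I \<Longrightarrow> dot r centroid (v x) \<le> \<alpha> + 1 / card I"
    and "I \<noteq> {} \<Longrightarrow> \<alpha> - 2 * \<alpha> * D / card I \<le> dot r centroid centroid"
    and "I \<noteq> {} \<Longrightarrow> dot r centroid centroid \<le> \<alpha> + 1 / card I"
proof -
  have lo: "\<alpha> - 2 * \<alpha> * D / card I \<le> dot r centroid (v x)" if "x \<in> I" for x
  proof -
    have n: "card I > 0" using that fin by (auto simp: card_gt_0_iff)
    have "\<alpha> * card (negs x) \<le> \<alpha> * D" using D[OF that] alpha_pos by simp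
    then have "card I * (\<alpha> - 2 * \<alpha> * D / card I) \<le> card I * dot r centroid (v x)"
      unfolding dot_centroid[OF that] using n alpha_le by (simp add: algebra_simps)
    with n show ?thesis by simp
  qed
  have hi: "dot r centroid (v x) \<le> \<alpha> + 1 / card I" if "x \<in> I" for x
  proof -
    have n: "card I > 0" using that fin by (auto simp: card_gt_0_iff)
    have "card I * dot r centroid (v x) \<le> card I * (\<alpha> + 1 / card I)"
      unfolding dot_centroid[OF that] using n alpha_pos by (simp add: algebra_simps)
    with n show ?thesis by simp
  qed
  show "x \<in> I \<Longrightarrow> \<alpha> - 2 * \<alpha> * D / card I \<le> dot r centroid (v x)"
    and "x \<in> I \<Longrightarrow> dot r centroid (v x) \<le> \<alpha> + 1 / card I"
    using lo hi by auto
  assume "I \<noteq> {}"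
  then have n: "card I > 0" using fin by (simp add: card_gt_0_iff)
  have "card I * (\<alpha> - 2 * \<alpha> * D / card I) \<le> card I * dot r centroid centroid"
    unfolding dot_centroid_self by (intro sum_bounded_below lo)
  with n show "\<alpha> - 2 * \<alpha> * D / card I \<le> dot r centroid centroid" by simp
  have "card I * dot r centroid centroid \<le> card I * (\<alpha> + 1 / card I)"
    unfolding dot_centroid_self by (intro sum_bounded_above hi)
  with n show "dot r centroid centroid \<le> \<alpha> + 1 / card I" by simp
qed

section \<open>Bootstrapping the degree bound, and the resulting bound by the dimension\<close>

lemma alpha_powers: "\<alpha>\<^sup>2 \<le> 1 / 16" "\<alpha> ^ 3 \<le> 1 / 64" "\<alpha> ^ 4 \<le> 1 / 256"
  using power_mono[OF alpha_le, of 2] power_mono[OF alpha_le, of 3]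
    power_mono[OF alpha_le, of 4] alpha_pos
  by (simp_all add: power_divide)

text \<open>The dichotomy is used for \<open>v x\<close> and the centroid. The centroid has squared
  norm at most \<open>2 * \<alpha>\<close> but products at least \<open>\<alpha> / 2\<close> with
  the family; its small norm gains a factor \<open>\<alpha>\<close> over the assumed degree
  bound.\<close>

lemma card_negs_le_cube:
  assumes large: "70 \<le> card I * \<alpha> ^ 4"
    and D: "\<And>x. x \<in> I \<Longrightarrow> card (negs x) * \<alpha> ^ 4 \<le> 1" and x: "x \<in> I"
  shows "card (negs x) * \<alpha> ^ 3 \<le> 8"
proof -
  define n where "n = real (card I)"
  define q where "q = dot r centroid centroid"
  have n: "n > 0" using x fin by (auto simp: n_def card_gt_0_iff)
  have inv_n: "1 / n \<le> \<alpha> ^ 4 / 70" using large n by (simp add: n_def field_simps)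
  have D': "card (negs y) \<le> 1 / \<alpha> ^ 4" if "y \<in> I" for y
    using D[OF that] alpha_pos by (simp add: field_simps)
  \<comment> \<open>The loss term of \<open>centroid_bounds\<close> for the degree bound
    \<open>1 / \<alpha> ^ 4\<close>; it is at most \<open>2 * \<alpha> / 70\<close>.\<close>
  have "2 * \<alpha> * (1 / \<alpha> ^ 4) / n \<le> 2 * \<alpha> * (1 / \<alpha> ^ 4) * (\<alpha> ^ 4 / 70)"
    using mult_left_mono[OF inv_n, of "2 * \<alpha> * (1 / \<alpha> ^ 4)"] alpha_pos by simp
  also have "\<dots> \<le> \<alpha> / 2" using alpha_pos by simp
  finally have lo: "\<alpha> / 2 \<le> dot r centroid (v y)" if "y \<in> I" for y
    using centroid_bounds(1)[OF D' that] by (simp add: n_def)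
  have "\<alpha> ^ 4 \<le> \<alpha>" using power_decreasing[of 1 4 \<alpha>] alpha_pos alpha_le by simp
  moreover have "q \<le> \<alpha> + 1 / n"
    using centroid_bounds(4)[OF D'] x by (auto simp: q_def n_def)
  ultimately have q: "q \<le> 2 * \<alpha>" using inv_n alpha_pos by linarith
  interpret J: equiangular_vectors r \<alpha> "I - {x}" v by (rule subfamily) auto
  have "card (negs x) * (\<alpha>\<^sup>2 / 2)\<^sup>2 \<le> 1 * q \<or> card (I - {x} - negs x) * (\<alpha>\<^sup>2 / 2)\<^sup>2 \<le> 1 * q"
    unfolding q_def unit[OF x, symmetric]
  proof (rule J.sign_dichotomy)
    fix i assume "i \<in> negs x"
    note dot_negs[OF x this]
    then show "dot r (v x) (v i) * dot r centroid (v i) \<le> - (\<alpha>\<^sup>2 / 2)"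
      using mult_left_mono[OF lo[of i], of \<alpha>] alpha_pos by (simp add: power2_eq_square)
  next
    fix i assume "i \<in> I - {x} - negs x"
    with x have "i \<in> I" "dot r (v x) (v i) = \<alpha>" by (auto simp: dot_eq)
    then show "\<alpha>\<^sup>2 / 2 \<le> dot r (v x) (v i) * dot r centroid (v i)"
      using mult_left_mono[OF lo[of i], of \<alpha>] alpha_pos by (simp add: power2_eq_square)
  qed (use negs_subset in auto)
  moreover have sq: "(\<alpha>\<^sup>2 / 2)\<^sup>2 = \<alpha> * \<alpha> ^ 3 / 4"
    by (simp add: power_divide eval_nat_numeral)
  have bound: "c * \<alpha> ^ 3 \<le> 8" if "c * (\<alpha>\<^sup>2 / 2)\<^sup>2 \<le> 1 * q" for c :: real
  proof -
    have "\<alpha> * (c * \<alpha> ^ 3) \<le> \<alpha> * 8" using that q unfolding sq by (simp add: mult_ac)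
    then show ?thesis using alpha_pos by simp
  qed
  \<comment> \<open>The other alternative fails: \<open>x\<close>, its neighbours and its
    non-neighbours together would be too few for
    \<open>70 \<le> card I * \<alpha> ^ 4\<close>.\<close>
  moreover have "\<not> card (I - {x} - negs x) * \<alpha> ^ 3 \<le> 8"
  proof
    assume "card (I - {x} - negs x) * \<alpha> ^ 3 \<le> 8"
    then have "\<alpha> * (card (I - {x} - negs x) * \<alpha> ^ 3) \<le> \<alpha> * 8" using alpha_pos by simp
    then have "card (I - {x} - negs x) * \<alpha> ^ 4 \<le> 2"
      using alpha_le by (simp add: eval_nat_numeral mult_ac)
    moreover have "card (I - {x} - negs x) = n - 1 - card (negs x)"
    proof -
      have "card (I - {x} - negs x) = card (I - {x}) - card (negs x)"
        by (intro card_Diff_subset negs_subset) simp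
      moreover have "card (negs x) \<le> card (I - {x})"
        by (intro card_mono negs_subset) (simp add: fin)
      moreover have "card (I - {x}) = n - 1"
        using x fin n by (simp add: n_def card_Diff_singleton of_nat_diff Suc_le_eq)
      ultimately show ?thesis by linarith
    qed
    ultimately have "n * \<alpha> ^ 4 \<le> 2 + \<alpha> ^ 4 + card (negs x) * \<alpha> ^ 4" by (simp add: algebra_simps)
    then show False using large D[OF x] alpha_powers by (simp add: n_def)
  qed
  ultimately show ?thesis by blast
qed

text \<open>Let \<open>k\<close> be the degree of \<open>x\<close> and \<open>g\<close> the sum of
  its centred neighbours. The centred \<open>x\<close> has norm at most 1 and product at most
  \<open>- k * \<alpha>\<close> with \<open>g\<close>, while the squared norm of \<open>g\<close> is
  at most \<open>k + k * k * \<alpha>\<^sup>2 / 2\<close>. Cauchy-Schwarz then bounds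
  \<open>k\<close>.\<close>

lemma card_negs_le_square:
  assumes large: "70 \<le> card I * \<alpha> ^ 4"
    and D: "\<And>x. x \<in> I \<Longrightarrow> card (negs x) * \<alpha> ^ 3 \<le> 8" and x: "x \<in> I"
  shows "card (negs x) * \<alpha>\<^sup>2 \<le> 2"
proof -
  define n k where "n = real (card I)" and "k = real (card (negs x))"
  define q where "q = dot r centroid centroid"
  \<comment> \<open>\<open>\<delta>\<close> is the loss in \<open>centroid_bounds\<close> for degree
    \<open>8 / \<alpha> ^ 3\<close>. A product \<open>\<alpha>\<close> becomes at most
    \<open>\<alpha> - 2 * (\<alpha> - \<delta>) + (\<alpha> + 1 / n)\<close> after centring, which
    is \<open>\<eta>\<close>.\<close>
  define \<delta> where "\<delta> = 2 * \<alpha> * (8 / \<alpha> ^ 3) / n"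
  define \<eta> where "\<eta> = 2 * \<delta> + 1 / n"
  define g where "g = (\<lambda>l. \<Sum>i\<in>negs x. (v i l - centroid l))"
  have n: "n > 0" using x fin by (auto simp: n_def card_gt_0_iff)
  have inv_n: "1 / n \<le> \<alpha> ^ 4 / 70" using large n by (simp add: n_def field_simps)
  have D': "card (negs y) \<le> 8 / \<alpha> ^ 3" if "y \<in> I" for y
    using D[OF that] alpha_pos by (simp add: field_simps)
  have \<delta>: "\<delta> \<le> 2 * \<alpha> * (8 / \<alpha> ^ 3) * (\<alpha> ^ 4 / 70)"
    using mult_left_mono[OF inv_n, of "2 * \<alpha> * (8 / \<alpha> ^ 3)"] alpha_pos by (simp add: \<delta>_def)
  also have "\<dots> = 16 / 70 * \<alpha>\<^sup>2" using alpha_pos by (simp add: eval_nat_numeral)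
  finally have \<delta>: "\<delta> \<le> 16 / 70 * \<alpha>\<^sup>2" .
  have "\<alpha> ^ 4 \<le> \<alpha>\<^sup>2" using power_decreasing[of 2 4 \<alpha>] alpha_pos alpha_le by simp
  then have \<eta>: "\<eta> \<le> \<alpha>\<^sup>2 / 2" using \<delta> inv_n zero_le_power2[of \<alpha>] unfolding \<eta>_def by linarith
  have "\<alpha>\<^sup>2 \<le> \<alpha>" using power_decreasing[of 1 2 \<alpha>] alpha_pos alpha_le by simp
  then have \<eta>': "\<eta> \<le> \<alpha>" using \<eta> alpha_pos by linarith
  have lo: "\<alpha> - \<delta> \<le> dot r centroid (v y)" if "y \<in> I" for y
    using centroid_bounds(1)[OF D' that] by (simp add: n_def \<delta>_def)
  have q: "q \<le> \<alpha> + 1 / n"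
    using centroid_bounds(4)[OF D'] x by (auto simp: q_def n_def)
  have "dot r (\<lambda>l. v x l - centroid l) g = (\<Sum>i\<in>negs x. dot r (v x) (v i) -
      dot r centroid (v x) - dot r centroid (v i) + q)"
    unfolding g_def dot_sum_right
    by (simp add: dot_linear q_def dot_commute[of r "v _" centroid] algebra_simps)
  also have "\<dots> \<le> (\<Sum>i\<in>negs x. - \<alpha>)"
  proof (rule sum_mono)
    fix i assume i: "i \<in> negs x"
    note dot_negs[OF x this]
    then show "dot r (v x) (v i) - dot r centroid (v x) - dot r centroid (v i) + q \<le> - \<alpha>"
      using lo[of i] lo[OF x] q \<eta>' unfolding \<eta>_def by linarith
  qed
  finally have "k * \<alpha> \<le> - dot r (\<lambda>l. v x l - centroid l) g" by (simp add: k_def)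
  then have "(k * \<alpha>)\<^sup>2 \<le> (- dot r (\<lambda>l. v x l - centroid l) g)\<^sup>2"
    using alpha_pos by (intro power_mono) (simp_all add: k_def)
  also have "\<dots> \<le> dot r (\<lambda>l. v x l - centroid l) (\<lambda>l. v x l - centroid l) * dot r g g"
    using dot_Cauchy_Schwarz by simp
  also have "\<dots> \<le> 1 * dot r g g"
  proof (rule mult_right_mono)
    have "dot r (\<lambda>l. v x l - centroid l) (\<lambda>l. v x l - centroid l) = 1 - 2 * dot r centroid (v x) + q"
      using unit[OF x] by (simp add: dot_linear q_def dot_commute[of r "v _" centroid])
    then show "dot r (\<lambda>l. v x l - centroid l) (\<lambda>l. v x l - centroid l) \<le> 1"
      using lo[OF x] q \<eta>' unfolding \<eta>_def by linarith
  qed (rule dot_self_nonneg)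
  also have "dot r g g = (\<Sum>i\<in>negs x. \<Sum>j\<in>negs x. dot r (v i) (v j) -
      dot r centroid (v i) - dot r centroid (v j) + q)"
    unfolding g_def dot_sum_right dot_sum_left
    by (simp add: dot_linear q_def dot_commute[of r "v _" centroid] algebra_simps)
      (intro sum.cong refl, simp add: dot_commute add.commute)
  also have "\<dots> \<le> (\<Sum>i\<in>negs x. \<Sum>j\<in>negs x. (if i = j then 1 else 0) + \<eta>)"
  proof (intro sum_mono)
    fix i j assume ij: "i \<in> negs x" "j \<in> negs x"
    then have I: "i \<in> I" "j \<in> I" using negs_subset by blast+
    then have "dot r (v i) (v j) \<le> (if i = j then 1 else 0) + \<alpha>"
      using alpha_pos by (auto simp: dot_eq)
    then show "dot r (v i) (v j) - dot r centroid (v i) - dot r centroid (v j) + q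
        \<le> (if i = j then 1 else 0) + \<eta>"
      using lo[OF I(1)] lo[OF I(2)] q unfolding \<eta>_def by linarith
  qed
  also have "\<dots> = k + k * k * \<eta>"
    by (simp add: sum.distrib k_def algebra_simps)
  also have "\<dots> \<le> k + k * k * (\<alpha>\<^sup>2 / 2)"
    using \<eta> by (intro add_left_mono mult_left_mono) (auto simp: k_def)
  finally have "k * (k * \<alpha>\<^sup>2) \<le> k * 2"
    by (simp add: power2_eq_square algebra_simps)
  moreover have "k = 0 \<or> 0 < k" by (auto simp: k_def)
  ultimately have "k * \<alpha>\<^sup>2 \<le> 2" by (auto dest: mult_left_le_imp_le)
  then show ?thesis by (simp add: k_def)
qed

text \<open>The centred vectors have a Gram matrix with trace at least \<open>n / 2\<close> and
  squared Frobenius norm at most \<open>20 * n\<close>. Then \<open>trace_squared_le\<close> gives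
  \<open>n * n / 4 \<le> 20 * r * n\<close>.\<close>

lemma card_le_dimension:
  assumes large: "70 \<le> card I * \<alpha> ^ 4"
    and D: "\<And>x. x \<in> I \<Longrightarrow> card (negs x) * \<alpha>\<^sup>2 \<le> 2"
  shows "card I \<le> 80 * r"
proof -
  define n where "n = real (card I)"
  define q where "q = dot r centroid centroid"
  define \<delta> where "\<delta> = 2 * \<alpha> * (2 / \<alpha>\<^sup>2) / n"
  \<comment> \<open>Here \<open>\<delta>\<close> equals \<open>4 / (\<alpha> * n)\<close>, so
    \<open>\<epsilon>\<close> dominates the centring error \<open>2 * \<delta> + 1 / n\<close> of a
    positive inner product.\<close>
  define \<epsilon> where "\<epsilon> = 9 / (\<alpha> * n)"
  define u where "u = (\<lambda>i l. v i l - centroid l)"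
  have ne: "I \<noteq> {}" using large by auto
  have n: "n > 0" using ne fin by (auto simp: n_def card_gt_0_iff)
  have big: "1120 \<le> n * \<alpha>\<^sup>2"
  proof -
    have "70 \<le> (n * \<alpha>\<^sup>2) * \<alpha>\<^sup>2" using large by (simp add: n_def eval_nat_numeral mult_ac)
    also have "\<dots> \<le> (n * \<alpha>\<^sup>2) * (1 / 16)"
      using n alpha_powers by (intro mult_left_mono) auto
    finally show ?thesis by simp
  qed
  have "n * \<alpha>\<^sup>2 \<le> n * 1" using n alpha_powers by (intro mult_left_mono) auto
  with big have "1120 \<le> n" by linarith
  then have inv_n: "1 / n \<le> 1 / 1120" using n by (simp add: field_simps)
  have D': "card (negs y) \<le> 2 / \<alpha>\<^sup>2" if "y \<in> I" for y
    using D[OF that] alpha_pos by (simp add: field_simps)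
  have \<delta>: "\<delta> = 4 / (\<alpha> * n)" by (simp add: \<delta>_def power2_eq_square)
  have n\<epsilon>: "1 / n \<le> 1 / (\<alpha> * n)" using alpha_pos alpha_le n by (simp add: field_simps)
  have \<delta>\<epsilon>: "2 * \<delta> + 1 / n \<le> \<epsilon>" "\<delta> + 2 / n \<le> \<epsilon>"
    using n\<epsilon> n alpha_pos unfolding \<delta> \<epsilon>_def by (auto simp: field_simps)
  have \<epsilon>: "0 \<le> \<epsilon>" "\<epsilon> \<le> \<alpha>"
    using big n alpha_pos by (auto simp: \<epsilon>_def field_simps power2_eq_square)
  have lo: "\<alpha> - \<delta> \<le> dot r centroid (v y)" if "y \<in> I" for y
    using centroid_bounds(1)[OF D' that] by (simp add: n_def \<delta>_def)
  have hi: "dot r centroid (v y) \<le> \<alpha> + 1 / n" if "y \<in> I" for y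
    using centroid_bounds(2)[OF D' that] by (simp add: n_def)
  have q: "\<alpha> - \<delta> \<le> q" "q \<le> \<alpha> + 1 / n"
    using centroid_bounds(3,4)[OF D'] ne by (auto simp: q_def n_def \<delta>_def)
  have dot_u: "dot r (u i) (u j) = dot r (v i) (v j) - dot r centroid (v i) - dot r centroid (v j) + q"
    for i j unfolding u_def by (simp add: dot_linear q_def dot_commute[of r "v _" centroid])
  have "(\<Sum>i\<in>I. dot r (u i) (u i)) = n - n * q"
    unfolding n_def q_def dot_centroid_self
    by (simp add: dot_u sum.distrib sum_subtractf unit q_def dot_centroid_self sum_distrib_left)
  also have "\<dots> \<ge> n / 2"
  proof -
    have "q \<le> 1 / 2" using q(2) alpha_le inv_n by linarith
    then show ?thesis using n mult_left_mono[of q "1/2" n] by simp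
  qed
  finally have trace: "n / 2 \<le> (\<Sum>i\<in>I. dot r (u i) (u i))" .
  have "(\<Sum>i\<in>I. \<Sum>j\<in>I. (dot r (u i) (u j))\<^sup>2) \<le>
      (\<Sum>i\<in>I. \<Sum>j\<in>I. (if i = j then 1 else 0) + (if j \<in> negs i then 9 * \<alpha>\<^sup>2 else 0) + \<epsilon>\<^sup>2)"
  proof (intro sum_mono)
    fix i j assume I: "i \<in> I" "j \<in> I"
    note bnds = lo[OF I(1)] lo[OF I(2)] hi[OF I(1)] hi[OF I(2)] q \<delta>\<epsilon> \<epsilon> alpha_pos alpha_le
    consider "i = j" | "i \<noteq> j" "j \<in> negs i" | "i \<noteq> j" "j \<notin> negs i" by blast
    then show "(dot r (u i) (u j))\<^sup>2 \<le>
        (if i = j then 1 else 0) + (if j \<in> negs i then 9 * \<alpha>\<^sup>2 else 0) + \<epsilon>\<^sup>2"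
    proof cases
      case 1
      then have "dot r (v i) (v j) = 1" using unit I by simp
      with bnds have "\<bar>dot r (u i) (u j)\<bar> \<le> 1" unfolding dot_u by linarith
      then have "(dot r (u i) (u j))\<^sup>2 \<le> 1" by (simp add: abs_square_le_1)
      moreover have "0 \<le> (if j \<in> negs i then 9 * \<alpha>\<^sup>2 else 0) + \<epsilon>\<^sup>2" by simp
      ultimately show ?thesis unfolding if_P[OF 1] by linarith
    next
      case 2
      then have "dot r (v i) (v j) = - \<alpha>" using I by (auto simp: dot_eq)
      with bnds have "\<bar>dot r (u i) (u j)\<bar> \<le> \<bar>3 * \<alpha>\<bar>" unfolding dot_u by linarith
      then have "(dot r (u i) (u j))\<^sup>2 \<le> (3 * \<alpha>)\<^sup>2" unfolding abs_le_square_iff .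
      with 2 show ?thesis by (simp add: power_mult_distrib add_increasing2)
    next
      case 3
      then have "dot r (v i) (v j) = \<alpha>" using I by (auto simp: dot_eq)
      with bnds have "\<bar>dot r (u i) (u j)\<bar> \<le> \<bar>\<epsilon>\<bar>" unfolding dot_u by linarith
      then have "(dot r (u i) (u j))\<^sup>2 \<le> \<epsilon>\<^sup>2" unfolding abs_le_square_iff .
      with 3 show ?thesis by simp
    qed
  qed
  also have "\<dots> = (\<Sum>i\<in>I. 1 + card (negs i) * (9 * \<alpha>\<^sup>2) + n * \<epsilon>\<^sup>2)"
  proof (intro sum.cong refl)
    fix i assume "i \<in> I"
    moreover have "I \<inter> negs i = negs i" using negs_subset by blast
    ultimately show "(\<Sum>j\<in>I. (if i = j then 1 else 0) + (if j \<in> negs i then 9 * \<alpha>\<^sup>2 else 0) + \<epsilon>\<^sup>2) =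
        1 + card (negs i) * (9 * \<alpha>\<^sup>2) + n * \<epsilon>\<^sup>2"
      using fin by (simp add: sum.distrib sum.If_cases n_def flip: sum.inter_restrict)
  qed
  \<comment> \<open>Each row contributes 1 from the diagonal, at most \<open>2 * 9\<close> from its
    at most \<open>2 / \<alpha>\<^sup>2\<close> neighbours, and at most 1 from the error
    terms.\<close>
  also have "\<dots> \<le> (\<Sum>i\<in>I. 20)"
  proof (rule sum_mono)
    fix i assume "i \<in> I"
    have "n * \<epsilon>\<^sup>2 \<le> 1"
      using big n alpha_pos by (auto simp: \<epsilon>_def field_simps power2_eq_square)
    then show "1 + card (negs i) * (9 * \<alpha>\<^sup>2) + n * \<epsilon>\<^sup>2 \<le> 20"
      using D[OF \<open>i \<in> I\<close>] by linarith
  qed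
  finally have frob: "(\<Sum>i\<in>I. \<Sum>j\<in>I. (dot r (u i) (u j))\<^sup>2) \<le> 20 * n"
    by (simp add: n_def)
  have "(n / 2)\<^sup>2 \<le> (\<Sum>i\<in>I. dot r (u i) (u i))\<^sup>2"
    using trace n by (intro power_mono) auto
  also have "\<dots> \<le> r * (20 * n)"
    using trace_squared_le[of r u I] mult_left_mono[OF frob, of r] by linarith
  finally have "n * n \<le> n * (80 * r)" by (simp add: power2_eq_square field_simps)
  then have "n \<le> 80 * r" using n by simp
  then show ?thesis by (simp add: n_def)
qed

section \<open>Switching signs, and the bound for arbitrary families\<close>

text \<open>Signs are switched so that a fixed \<open>x0\<close> has product \<open>\<alpha>\<close>
  with all other vectors. Each remaining vector then has either few negative or few positive
  products. Vectors of the second kind are nearly all mutually negative, so they are few and can be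
  discarded.\<close>

lemma switch_to_few_negs:
  assumes large: "8 \<le> (real (card I) - 1) * \<alpha> ^ 4"
  obtains J \<epsilon> where
    "J \<subseteq> I" "real (card I) - 1 \<le> 2 * real (card J)"
    "equiangular_vectors r \<alpha> J (\<lambda>i k. \<epsilon> i * v i k)"
    "\<And>x. x \<in> J \<Longrightarrow> card (equiangular_vectors.negs r J (\<lambda>i k. \<epsilon> i * v i k) x) * \<alpha> ^ 4 \<le> 1"
proof -
  obtain x0 where x0: "x0 \<in> I" using large zero_less_power[OF alpha_pos, of 4] by (cases "I = {}") auto
  define \<epsilon> :: "'a \<Rightarrow> real" where "\<epsilon> = (\<lambda>i. if i \<noteq> x0 \<and> dot r (v x0) (v i) < 0 then -1 else 1)"
  define w where "w = (\<lambda>i k. \<epsilon> i * v i k)"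
  define I' where "I' = I - {x0}"
  have \<epsilon>: "\<bar>\<epsilon> i\<bar> = 1" "\<epsilon> i * \<epsilon> i = 1" for i by (auto simp: \<epsilon>_def)
  interpret S: equiangular_vectors r \<alpha> I w
  proof
    fix i j assume "i \<in> I" "j \<in> I" "i \<noteq> j"
    then show "\<bar>dot r (w i) (w j)\<bar> = \<alpha>"
      by (simp add: w_def dot_linear abs_mult \<epsilon> angle)
  qed (use fin alpha_pos alpha_le in
      \<open>simp_all add: w_def dot_linear \<epsilon> unit flip: mult.assoc\<close>)
  have w0: "dot r (w x0) (w i) = \<alpha>" if "i \<in> I'" for i
    using that angle[OF x0, of i] by (auto simp: w_def dot_linear \<epsilon>_def I'_def)
  interpret S': equiangular_vectors r \<alpha> I' w
    by (rule S.subfamily) (auto simp: I'_def)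
  have card_I': "real (card I') = real (card I) - 1"
  proof -
    have "card I > 0" using x0 fin by (auto simp: card_gt_0_iff)
    then show ?thesis using x0 fin by (simp add: I'_def card_Diff_singleton of_nat_diff)
  qed
  \<comment> \<open>All products with \<open>w x0\<close> are \<open>\<alpha>\<close>, so the sign
    of the product in \<open>sign_dichotomy\<close> is that of \<open>dot r (w x) (w i)\<close>, and
    \<open>\<beta>\<close> is \<open>\<alpha>\<^sup>2\<close>.\<close>
  have dich: "card (S'.negs x) * \<alpha> ^ 4 \<le> 1 \<or> card (I' - {x} - S'.negs x) * \<alpha> ^ 4 \<le> 1"
    if x: "x \<in> I'" for x
  proof -
    interpret X: equiangular_vectors r \<alpha> "I' - {x}" w
      by (rule S'.subfamily) auto
    have "card (S'.negs x) * (\<alpha>\<^sup>2)\<^sup>2 \<le> dot r (w x0) (w x0) * dot r (w x) (w x) \<or>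
        card (I' - {x} - S'.negs x) * (\<alpha>\<^sup>2)\<^sup>2 \<le> dot r (w x0) (w x0) * dot r (w x) (w x)"
    proof (rule X.sign_dichotomy)
      fix i assume "i \<in> S'.negs x"
      note S'.dot_negs[OF x this]
      then show "dot r (w x0) (w i) * dot r (w x) (w i) \<le> - (\<alpha>\<^sup>2)"
        by (simp add: w0 power2_eq_square)
    next
      fix i assume "i \<in> I' - {x} - S'.negs x"
      with x show "\<alpha>\<^sup>2 \<le> dot r (w x0) (w i) * dot r (w x) (w i)"
        by (simp add: w0 S'.dot_eq power2_eq_square)
    qed (use S'.negs_subset in auto)
    then show ?thesis by (simp add: S.unit[OF x0] S'.unit[OF x])
  qed
  define F where "F = {x \<in> I'. card (I' - {x} - S'.negs x) * \<alpha> ^ 4 \<le> 1}"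
  have F: "F \<subseteq> I'" by (auto simp: F_def)
  interpret FF: equiangular_vectors r \<alpha> F w
    by (rule S'.subfamily[OF F])
  \<comment> \<open>If \<open>F\<close> were larger, every row sum of its Gram matrix would be
    negative, and so would the squared norm of the sum of its vectors.\<close>
  have small: "real (card F) * \<alpha> ^ 4 < 4"
  proof (rule ccontr)
    assume "\<not> real (card F) * \<alpha> ^ 4 < 4"
    then have big: "4 \<le> real (card F) * \<alpha> ^ 4" by simp
    have "F \<noteq> {}" using big by auto
    have "0 \<le> dot r (\<lambda>k. \<Sum>i\<in>F. w i k) (\<lambda>k. \<Sum>i\<in>F. w i k)"
      by (rule dot_self_nonneg)
    also have "\<dots> = (\<Sum>i\<in>F. \<Sum>j\<in>F. dot r (w i) (w j))"
      by (simp add: dot_linear)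
    also have "\<dots> < (\<Sum>i\<in>F. 0)"
    proof (rule sum_strict_mono[OF FF.fin \<open>F \<noteq> {}\<close>])
      fix x assume x: "x \<in> F"
      have "F - {x} - FF.negs x \<subseteq> I' - {x} - S'.negs x"
        using F by (auto simp: FF.negs_def S'.negs_def)
      then have "card (F - {x} - FF.negs x) \<le> card (I' - {x} - S'.negs x)"
        by (intro card_mono) (auto simp: S'.fin)
      moreover have "card (F - {x} - FF.negs x) = card (F - {x}) - card (FF.negs x)"
        by (intro card_Diff_subset FF.negs_subset) simp
      moreover have "card (F - {x}) = card F - 1" using x FF.fin by (simp add: card_Diff_singleton)
      ultimately have "real (card F) - 1 - real (card (FF.negs x)) \<le> real (card (I' - {x} - S'.negs x))"
        by linarith
      then have "(real (card F) - 1 - real (card (FF.negs x))) * \<alpha> ^ 4 \<le>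
          card (I' - {x} - S'.negs x) * \<alpha> ^ 4"
        using alpha_pos by (intro mult_right_mono) auto
      also have "\<dots> \<le> 1" using x by (simp add: F_def)
      finally have "real (card F) * \<alpha> ^ 4 - \<alpha> ^ 4 - card (FF.negs x) * \<alpha> ^ 4 \<le> 1"
        by (simp add: algebra_simps)
      moreover have "\<alpha> ^ 3 * (1 + \<alpha> * (real (card F) - 1) - 2 * \<alpha> * card (FF.negs x)) =
          \<alpha> ^ 3 + real (card F) * \<alpha> ^ 4 - \<alpha> ^ 4 - 2 * (card (FF.negs x) * \<alpha> ^ 4)"
        by (simp add: numeral_eq_Suc algebra_simps)
      ultimately have "\<alpha> ^ 3 * (1 + \<alpha> * (real (card F) - 1) - 2 * \<alpha> * card (FF.negs x)) < 0"
        using big alpha_powers by linarith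
      then show "(\<Sum>j\<in>F. dot r (w x) (w j)) < 0"
        unfolding FF.row_sum[OF x] using alpha_pos by (simp add: mult_less_0_iff)
    qed
    finally show False by simp
  qed
  show thesis
  proof (rule that[of "I' - F" \<epsilon>, folded w_def])
    show "I' - F \<subseteq> I" by (auto simp: I'_def)
    have "card I' = card (I' - F) + card F"
      using F S'.fin by (metis card_Diff_subset card_mono le_add_diff_inverse2 finite_subset)
    moreover have "2 * real (card F) \<le> card I'"
    proof -
      have "(2 * real (card F)) * \<alpha> ^ 4 \<le> card I' * \<alpha> ^ 4"
        using small large by (simp add: card_I')
      then show ?thesis using alpha_pos by simp
    qed
    ultimately show "real (card I) - 1 \<le> 2 * real (card (I' - F))"
      using card_I' by linarith
    show eqv: "equiangular_vectors r \<alpha> (I' - F) w"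
      by (rule S'.subfamily) auto
    interpret J: equiangular_vectors r \<alpha> "I' - F" w by (rule eqv)
    fix x assume x: "x \<in> I' - F"
    then have "card (S'.negs x) * \<alpha> ^ 4 \<le> 1" using dich[of x] by (auto simp: F_def)
    moreover have "card (J.negs x) \<le> card (S'.negs x)"
      by (intro card_mono S'.finite_negs) (auto simp: J.negs_def S'.negs_def)
    then have "card (J.negs x) * \<alpha> ^ 4 \<le> card (S'.negs x) * \<alpha> ^ 4"
      using alpha_pos by (intro mult_right_mono) auto
    ultimately show "card (J.negs x) * \<alpha> ^ 4 \<le> 1" by linarith
  qed
qed

text \<open>The threshold 140 leaves at least \<open>70 / \<alpha> ^ 4\<close> vectors after
  switching has halved the family, as the bootstrapping lemmas require; halving also turns 80 into
  160.\<close>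

lemma card_le:
  "card I \<le> 1 + 140 / \<alpha> ^ 4 + 160 * real r"
proof (cases "140 \<le> (real (card I) - 1) * \<alpha> ^ 4")
  case True
  then have "8 \<le> (real (card I) - 1) * \<alpha> ^ 4" by linarith
  then obtain J \<epsilon> where J: "real (card I) - 1 \<le> 2 * real (card J)"
    "equiangular_vectors r \<alpha> J (\<lambda>i k. \<epsilon> i * v i k)"
    "\<And>x. x \<in> J \<Longrightarrow> card (equiangular_vectors.negs r J (\<lambda>i k. \<epsilon> i * v i k) x) * \<alpha> ^ 4 \<le> 1"
    by (rule switch_to_few_negs) blast
  interpret J: equiangular_vectors r \<alpha> J "\<lambda>i k. \<epsilon> i * v i k" by (rule J)
  have "140 \<le> 2 * real (card J) * \<alpha> ^ 4"
    using True mult_right_mono[OF J(1), of "\<alpha> ^ 4"] zero_le_power[of \<alpha> 4] alpha_pos by linarith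
  then have "70 \<le> real (card J) * \<alpha> ^ 4" by simp
  then have "card J \<le> 80 * r"
    using J(3) by (intro J.card_le_dimension J.card_negs_le_square J.card_negs_le_cube)
  moreover have "0 \<le> 140 / \<alpha> ^ 4" using alpha_pos by simp
  ultimately show ?thesis using J(1) by linarith
next
  case False
  then have "real (card I) - 1 \<le> 140 / \<alpha> ^ 4"
    using alpha_pos by (simp add: field_simps)
  then show ?thesis by simp
qed

end

section \<open>Passage from lines to unit vectors\<close>

lemma equiangular_imp_equiangular_vectors:
  assumes "equiangular r \<alpha> L" "finite L" "0 < \<alpha>" "\<alpha> \<le> 1 / 4"
  obtains v where "equiangular_vectors r \<alpha> L v"
proof -
  from assms(1) obtain v where L: "L \<subseteq> lines_through_origin r"
    and v: "\<forall>l\<in>L. v l \<in> l \<and> v l \<bullet> v l = 1"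
      "\<forall>l\<in>L. \<forall>m\<in>L. l \<noteq> m \<longrightarrow> \<bar>v l \<bullet> v m\<bar> = \<alpha>"
    unfolding equiangular_def by blast
  have dot: "dot r (\<lambda>k. v l $ k) (\<lambda>k. v m $ k) = v l \<bullet> v m" if "m \<in> L" for l m
  proof -
    have "dim_vec (v m) = r"
      using v(1) that L by (fastforce simp: lines_through_origin_def)
    then show ?thesis by (simp add: dot_def scalar_prod_def lessThan_atLeast0)
  qed
  have "equiangular_vectors r \<alpha> L (\<lambda>l k. v l $ k)"
    by unfold_locales (use assms v in \<open>simp_all add: dot\<close>)
  then show thesis by (rule that)
qed

lemma card_equiangular_le:
  assumes "equiangular r \<alpha> L" "finite L" "0 < \<alpha>" "\<alpha> \<le> 1 / 4"
  shows "card L \<le> 1 + 140 / \<alpha> ^ 4 + 160 * real r"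
proof -
  obtain v where "equiangular_vectors r \<alpha> L v"
    using assms by (rule equiangular_imp_equiangular_vectors)
  then show ?thesis by (rule equiangular_vectors.card_le)
qed

section \<open>Lower bound from Kerdock sets\<close>

lemma add_power_char_two:
  fixes x y :: "'a::comm_ring_1"
  assumes "(2::'a) = 0"
  shows "(x + y) ^ 2 ^ k = x ^ 2 ^ k + y ^ 2 ^ k"
  by (induction k) (simp_all add: power_mult mult.commute[of 2] power2_sum assms)

lemma sum_square_char_two:
  fixes f :: "'b \<Rightarrow> 'a::comm_ring_1"
  assumes "(2::'a) = 0"
  shows "(\<Sum>i\<in>A. f i)\<^sup>2 = (\<Sum>i\<in>A. (f i)\<^sup>2)"
  by (induction A rule: infinite_finite_induct) (simp_all add: power2_sum assms)

text \<open>The fixed points are the roots of \<open>p\<close>, that is of \<open>x ^ n - x\<close>.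
  Its derivative is the constant -1, so a root cannot be repeated, and over an algebraically closed
  field there are as many roots as the degree.\<close>

lemma card_Frobenius_fixed:
  assumes two: "(2::'a::alg_closed_field) = 0" and "m > 0"
  shows "card {x::'a. x ^ 2 ^ m = x} = 2 ^ m"
proof -
  define n :: nat where "n = 2 ^ m"
  have n: "n > 1" using one_less_power[of "2::nat" m] \<open>m > 0\<close> by (simp add: n_def)
  define p :: "'a poly" where "p = monom 1 n + [:0, -1:]"
  have deg: "degree p = n"
    unfolding p_def using n by (subst degree_add_eq_left) (auto simp: degree_monom_eq)
  have "of_nat n = (0::'a)" using two \<open>m > 0\<close> by (simp add: n_def)
  then have deriv: "poly (pderiv p) x = -1" for x
    by (simp add: p_def pderiv_add pderiv_monom pderiv_pCons)
  have "p \<noteq> 0" using deg n by auto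
  then obtain A where A: "size A = n" "p = smult (lead_coeff p) (\<Prod>x\<in>#A. [:-x, 1:])"
    using alg_closed_imp_factorization[of p] deg by metis
  have roots: "poly p x = 0 \<longleftrightarrow> x \<in># A" for x
    using \<open>p \<noteq> 0\<close> by (subst A(2)) (auto simp: poly_prod_mset prod_mset_zero_iff)
  have "count A x = 1" if "x \<in># A" for x
  proof (rule ccontr)
    assume "count A x \<noteq> 1"
    moreover from that obtain B where B: "A = add_mset x B"
      by (blast dest: multi_member_split)
    ultimately have "x \<in># B" by (auto simp: not_in_iff)
    then obtain C where "A = add_mset x (add_mset x C)"
      using B by (metis multi_member_split)
    then have "p = [:-x, 1:] * ([:-x, 1:] * smult (lead_coeff p) (\<Prod>x\<in>#C. [:-x, 1:]))"
      using A(2) by (simp add: mult_ac)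
    then obtain q where "p = [:-x, 1:] * ([:-x, 1:] * q)" by blast
    then have "poly (pderiv p) x = 0"
      by (simp only: pderiv_mult poly_add poly_mult) simp
    with deriv show False by simp
  qed
  then have "n = card (set_mset A)"
    using A(1) by (simp add: size_multiset_overloaded_eq)
  also have "set_mset A = {x. x ^ n = x}"
    unfolding set_eq_iff roots[symmetric] by (simp add: p_def poly_monom)
  finally show ?thesis by (simp add: n_def)
qed

section \<open>Character sums and Gauss sums\<close>

text \<open>Translation by \<open>w\<close> permutes \<open>V\<close> and multiplies the sum by
  \<open>\<beta> w\<close>, which differs from 1.\<close>

lemma nontrivial_character_sum:
  fixes \<beta> :: "'g::ab_group_add \<Rightarrow> real"
  assumes "w \<in> V" "\<beta> w \<noteq> 1"
    and closed: "\<And>z. z \<in> V \<Longrightarrow> z + w \<in> V" and self: "w + w = 0"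
    and mult: "\<And>z. z \<in> V \<Longrightarrow> \<beta> (z + w) = \<beta> z * \<beta> w"
  shows "(\<Sum>z\<in>V. \<beta> z) = 0"
proof -
  have "(\<Sum>z\<in>V. \<beta> z) = (\<Sum>z\<in>V. \<beta> (z + w))"
    by (rule sum.reindex_bij_witness[of _ "\<lambda>z. z + w" "\<lambda>z. z + w"])
      (simp_all add: closed self add.assoc)
  also have "\<dots> = (\<Sum>z\<in>V. \<beta> z) * \<beta> w"
    by (simp add: mult sum_distrib_right)
  finally show ?thesis using \<open>\<beta> w \<noteq> 1\<close> by simp
qed

text \<open>In the squared sum, substitute \<open>z + u\<close> for the second variable: the term
  becomes \<open>\<psi> u * \<beta> z u\<close>, and by \<open>orth\<close> only
  \<open>u = 0\<close> survives the summation over \<open>z\<close>.\<close>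

lemma quadratic_Gauss_sum:
  fixes \<psi> :: "'g::ab_group_add \<Rightarrow> real"
  assumes "0 \<in> V"
    and closed: "\<And>z w. z \<in> V \<Longrightarrow> w \<in> V \<Longrightarrow> z + w \<in> V"
    and self: "\<And>w. w \<in> V \<Longrightarrow> w + w = 0"
    and sign: "\<And>z. z \<in> V \<Longrightarrow> \<psi> z * \<psi> z = 1" and "\<psi> 0 = 1"
    and polar: "\<And>z u. z \<in> V \<Longrightarrow> u \<in> V \<Longrightarrow> \<psi> (z + u) = \<psi> z * \<psi> u * \<beta> z u"
    and orth: "\<And>u. u \<in> V \<Longrightarrow> u \<noteq> 0 \<Longrightarrow> (\<Sum>z\<in>V. \<beta> z u) = 0"
  shows "(\<Sum>z\<in>V. \<psi> z)\<^sup>2 = card V"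
\<comment> \<open>For infinite \<open>V\<close> both sides are 0 by convention.\<close>
proof (cases "finite V")
  case True
  have \<beta>_0: "\<beta> z 0 = 1" if "z \<in> V" for z
  proof -
    have "\<psi> z * \<psi> z = \<psi> z * \<psi> z * \<beta> z 0"
      using polar[OF that \<open>0 \<in> V\<close>] \<open>\<psi> 0 = 1\<close> by simp
    with sign[OF that] show ?thesis by simp
  qed
  have "(\<Sum>z\<in>V. \<psi> z)\<^sup>2 = (\<Sum>z\<in>V. \<Sum>w\<in>V. \<psi> z * \<psi> w)"
    by (simp add: power2_eq_square sum_product)
  also have "\<dots> = (\<Sum>z\<in>V. \<Sum>u\<in>V. \<psi> u * \<beta> z u)"
  proof (rule sum.cong[OF refl])
    fix z assume z: "z \<in> V"
    have cancel: "z + (z + w) = w" for w by (simp add: self[OF z] flip: add.assoc)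
    show "(\<Sum>w\<in>V. \<psi> z * \<psi> w) = (\<Sum>u\<in>V. \<psi> u * \<beta> z u)"
    proof (rule sum.reindex_bij_witness[of _ "\<lambda>u. z + u" "\<lambda>w. z + w"])
      fix w assume w: "w \<in> V"
      have "\<psi> w = \<psi> z * \<psi> (z + w) * \<beta> z (z + w)"
        using polar[OF z closed[OF z w]] by (simp add: cancel)
      then show "\<psi> (z + w) * \<beta> z (z + w) = \<psi> z * \<psi> w"
        using sign[OF z] by (simp flip: mult.assoc)
    qed (simp_all add: cancel closed z)
  qed
  also have "\<dots> = (\<Sum>u\<in>V. \<psi> u * (\<Sum>z\<in>V. \<beta> z u))"
    by (subst sum.swap) (simp add: sum_distrib_left)
  also have "\<dots> = (\<Sum>u\<in>V. if u = 0 then real (card V) else 0)"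
    by (intro sum.cong) (auto simp: orth \<beta>_0 \<open>\<psi> 0 = 1\<close>)
  also have "\<dots> = card V" using True \<open>0 \<in> V\<close> by simp
  finally show ?thesis .
qed simp

section \<open>The field of odd degree, its trace and its quadratic trace form\<close>

text \<open>\<open>K\<close> is the field of order \<open>2 ^ (2 * h + 1)\<close> as a subset of an
  ambient field, so one type serves every \<open>h\<close>. The prime field appears as the subset
  \<open>{0, 1}\<close>.\<close>

locale odd_binary_field =
  fixes h :: nat and K :: "'a::field set"
  assumes two: "(2::'a) = 0"
    and K_eq: "K = {x. x ^ 2 ^ (2 * h + 1) = x}"
    and card_K: "card K = 2 ^ (2 * h + 1)"
begin

lemma finite_K [simp]: "finite K"
  by (rule card_ge_0_finite) (simp add: card_K)

lemma add_self [simp]: "x + x = (0::'a)"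
  using two by (metis mult_2 mult_zero_left)

lemma add_self_left [simp]: "x + (x + y) = (y::'a)"
  by (simp flip: add.assoc)

lemma add_eq_0_iff_eq: "x + y = 0 \<longleftrightarrow> x = (y::'a)"
  by (metis add_self add_self_left add_0_right)

lemmas Frobenius_add = add_power_char_two[OF two]

lemma K_0 [simp]: "0 \<in> K" and K_1 [simp]: "1 \<in> K"
  and K_mult [simp]: "x \<in> K \<Longrightarrow> y \<in> K \<Longrightarrow> x * y \<in> K"
  and K_inverse [simp]: "x \<in> K \<Longrightarrow> inverse x \<in> K"
  by (simp_all add: K_eq power_mult_distrib power_inverse)

lemma K_add [simp]: "x \<in> K \<Longrightarrow> y \<in> K \<Longrightarrow> x + y \<in> K"
  by (simp only: K_eq mem_Collect_eq Frobenius_add)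

lemma K_power [simp]: "x \<in> K \<Longrightarrow> x ^ n \<in> K"
  by (induction n) auto

lemma bits_add [simp]: "a \<in> {0, 1} \<Longrightarrow> b \<in> {0, 1} \<Longrightarrow> a + b \<in> {0, 1::'a}"
  by auto

lemma bits_mult [simp]: "a \<in> {0, 1} \<Longrightarrow> b \<in> {0, 1} \<Longrightarrow> a * b \<in> {0, 1::'a}"
  by auto

lemma bits_sum: "(\<And>i. i \<in> A \<Longrightarrow> f i \<in> {0, 1}) \<Longrightarrow> (\<Sum>i\<in>A. f i) \<in> {0, 1::'a}"
proof (induction A rule: infinite_finite_induct)
  case (insert x F)
  then show ?case using bits_add[of "f x" "sum f F"] by simp
qed auto

definition tr :: "'a \<Rightarrow> 'a" where
  "tr x = (\<Sum>i<2 * h + 1. x ^ 2 ^ i)"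

lemma tr_0 [simp]: "tr 0 = 0"
  by (simp add: tr_def power_0_left)

text \<open>The odd degree enters here: the sum of \<open>2 * h + 1\<close> ones is 1 in
  characteristic two.\<close>

lemma tr_1 [simp]: "tr 1 = 1"
  by (simp add: tr_def two)

lemma tr_add: "tr (x + y) = tr x + tr y"
  by (simp only: tr_def Frobenius_add sum.distrib)

lemma tr_sum: "tr (\<Sum>i\<in>A. f i) = (\<Sum>i\<in>A. tr (f i))"
  by (induction A rule: infinite_finite_induct) (simp_all add: tr_add)

lemma tr_mult_bit: "a \<in> {0, 1} \<Longrightarrow> tr (x * a) = tr x * a"
  by auto

text \<open>Squaring shifts the conjugates cyclically, since the last one,
  \<open>x ^ 2 ^ (2 * h + 1)\<close>, is \<open>x\<close> again.\<close>

lemma tr_square: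
  assumes "x \<in> K"
  shows "tr (x\<^sup>2) = tr x"
proof -
  have "tr (x\<^sup>2) + x = (\<Sum>i<Suc (2 * h + 1). x ^ 2 ^ i)"
    unfolding tr_def by (subst sum.lessThan_Suc_shift) (simp add: power_mult[symmetric] add.commute)
  also have "\<dots> = tr x + x"
    using assms by (simp add: tr_def K_eq)
  finally show ?thesis by simp
qed

lemma tr_Frobenius: "x \<in> K \<Longrightarrow> tr (x ^ 2 ^ k) = tr x"
  by (induction k) (simp_all add: power_mult mult.commute[of 2] tr_square)

lemma tr_bit:
  assumes "x \<in> K"
  shows "tr x \<in> {0, 1}"
proof -
  have "(tr x)\<^sup>2 = tr (x\<^sup>2)"
    by (simp only: tr_def sum_square_char_two[OF two] mult.commute power_mult[symmetric])
  then have "tr x * (tr x + 1) = 0"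
    by (simp add: tr_square[OF assms] distrib_left flip: power2_eq_square)
  then show ?thesis by (simp add: add_eq_0_iff_eq)
qed

text \<open>The second elementary symmetric function of the conjugates of \<open>x\<close>. Its summands
  \<open>x^(2^i + 2^j)\<close> are grouped by the cyclic distance \<open>k\<close> of \<open>i\<close> and \<open>j\<close>, which
  makes every group a trace because the degree \<open>2 * h + 1\<close> is odd.\<close>

definition qtr :: "'a \<Rightarrow> 'a" where
  "qtr x = (\<Sum>k=1..h. tr (x * x ^ 2 ^ k))"

lemma qtr_bit: "x \<in> K \<Longrightarrow> qtr x \<in> {0, 1}"
  unfolding qtr_def by (intro bits_sum tr_bit) simp

text \<open>The mixed term \<open>y * x ^ 2 ^ k\<close> is conjugate to
  \<open>x * y ^ 2 ^ (2 * h + 1 - k)\<close>. Hence the two halves of the mixed terms combine to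
  \<open>g k\<close> for \<open>k\<close> from 1 to \<open>2 * h\<close>, that is, to the trace of
  \<open>x\<close> times all conjugates of \<open>y\<close> except \<open>y\<close> itself.\<close>

lemma qtr_add:
  assumes x: "x \<in> K" and y: "y \<in> K"
  shows "qtr (x + y) = qtr x + qtr y + (tr x * tr y + tr (x * y))"
proof -
  define g where "g = (\<lambda>k. tr (x * y ^ 2 ^ k))"
  have swap: "tr (y * x ^ 2 ^ k) = g (2 * h + 1 - k)" if "k \<le> 2 * h + 1" for k
  proof -
    have "(x ^ 2 ^ k) ^ 2 ^ (2 * h + 1 - k) = x ^ 2 ^ (2 * h + 1)"
      using that by (simp flip: power_mult power_add)
    also have "\<dots> = x" using x by (simp add: K_eq)
    finally have "(y * x ^ 2 ^ k) ^ 2 ^ (2 * h + 1 - k) = x * y ^ 2 ^ (2 * h + 1 - k)"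
      by (simp add: power_mult_distrib mult.commute)
    then show ?thesis
      unfolding g_def using tr_Frobenius[of "y * x ^ 2 ^ k"] x y by (metis K_mult K_power)
  qed
  have "qtr (x + y) = (\<Sum>k=1..h. tr (x * x ^ 2 ^ k) + tr (y * y ^ 2 ^ k) + (g k + tr (y * x ^ 2 ^ k)))"
    unfolding qtr_def g_def by (intro sum.cong refl) (simp add: Frobenius_add tr_add algebra_simps)
  also have "\<dots> = qtr x + qtr y + ((\<Sum>k=1..h. g k) + (\<Sum>k=1..h. tr (y * x ^ 2 ^ k)))"
    by (simp add: qtr_def sum.distrib)
  also have "(\<Sum>k=1..h. tr (y * x ^ 2 ^ k)) = (\<Sum>k=h+1..2*h. g k)"
    by (rule sum.reindex_bij_witness[of _ "\<lambda>k. 2 * h + 1 - k" "\<lambda>k. 2 * h + 1 - k"])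
      (auto simp: swap)
  also have "(\<Sum>k=1..h. g k) + \<dots> = (\<Sum>k=1..2*h. g k)"
    by (rule sum.ub_add_nat[symmetric, of 1 h _ h, folded mult_2]) simp
  also have "\<dots> = tr (x * (\<Sum>k=1..2*h. y ^ 2 ^ k))"
    by (simp add: g_def tr_sum sum_distrib_left)
  also have "(\<Sum>k=1..2*h. y ^ 2 ^ k) = tr y + y"
  proof -
    have "tr y = y + (\<Sum>k<2*h. y ^ 2 ^ Suc k)"
      unfolding tr_def Suc_eq_plus1[symmetric] sum.lessThan_Suc_shift by simp
    then show ?thesis by (simp add: sum.atLeast1_atMost_eq add_ac)
  qed
  also have "tr (x * (tr y + y)) = tr x * tr y + tr (x * y)"
    using tr_bit[OF y] by (simp add: distrib_left tr_add tr_mult_bit)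
  finally show ?thesis .
qed

section \<open>Kerdock forms and their nondegenerate differences\<close>

text \<open>The extra bit makes the dimension over the prime field even, as a nondegenerate
  alternating form requires.\<close>

definition V :: "('a \<times> 'a) set" where
  "V = K \<times> {0, 1}"

text \<open>Kerdock's quadratic forms \<open>Q s\<close>, with polarisation \<open>B s\<close>.\<close>

definition Q :: "'a \<Rightarrow> 'a \<times> 'a \<Rightarrow> 'a" where
  "Q s z = qtr (s * fst z) + snd z * tr (s * fst z)"

definition B :: "'a \<Rightarrow> 'a \<times> 'a \<Rightarrow> 'a \<times> 'a \<Rightarrow> 'a" where
  "B s z w = tr (s * fst z) * tr (s * fst w) + tr (s * fst z * (s * fst w))
     + snd z * tr (s * fst w) + snd w * tr (s * fst z)"

definition L :: "'a \<times> 'a \<Rightarrow> 'a \<times> 'a \<Rightarrow> 'a" where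
  "L y z = tr (fst y * fst z) + snd y * snd z"

definition chi :: "'a \<Rightarrow> real" where
  "chi a = (if a = 0 then 1 else -1)"

lemma chi_square [simp]: "chi a * chi a = 1"
  by (simp add: chi_def)

lemma chi_add: "a \<in> {0, 1} \<Longrightarrow> b \<in> {0, 1} \<Longrightarrow> chi (a + b) = chi a * chi b"
  by (auto simp: chi_def)

lemma chi_0 [simp]: "chi 0 = 1" and chi_1 [simp]: "chi 1 = -1"
  by (simp_all add: chi_def)

lemma finite_V [simp]: "finite V" and card_V: "card V = (2 ^ (h + 1))\<^sup>2"
  by (simp_all add: V_def card_K power2_eq_square flip: power_add)

lemma V_0: "0 \<in> V" and V_add: "z \<in> V \<Longrightarrow> w \<in> V \<Longrightarrow> z + w \<in> V"
  by (auto simp: V_def zero_prod_def)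

lemma V_self: "(z :: 'a \<times> 'a) + z = 0"
  by (simp add: prod_eq_iff)

lemma VD: "z \<in> V \<Longrightarrow> fst z \<in> K" "z \<in> V \<Longrightarrow> snd z \<in> {0, 1}"
  by (auto simp: V_def)

lemma Q_bit: "s \<in> K \<Longrightarrow> z \<in> V \<Longrightarrow> Q s z \<in> {0, 1}"
  unfolding Q_def by (intro bits_add bits_mult qtr_bit tr_bit K_mult VD)

lemma L_bit: "y \<in> V \<Longrightarrow> z \<in> V \<Longrightarrow> L y z \<in> {0, 1}"
  unfolding L_def by (intro bits_add bits_mult tr_bit K_mult VD)

lemma B_bit: "s \<in> K \<Longrightarrow> z \<in> V \<Longrightarrow> w \<in> V \<Longrightarrow> B s z w \<in> {0, 1}"
  unfolding B_def by (intro bits_add bits_mult tr_bit K_mult VD)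

lemma Q_add:
  assumes "s \<in> K" "z \<in> V" "w \<in> V"
  shows "Q s (z + w) = Q s z + Q s w + B s z w"
proof -
  have "s * fst z \<in> K" "s * fst w \<in> K" using assms VD by auto
  then show ?thesis
    by (simp only: Q_def B_def fst_add snd_add distrib_left distrib_right qtr_add tr_add)
      (simp add: add_ac)
qed

lemma L_add: "L y (z + w) = L y z + L y w"
  by (simp add: L_def distrib_left tr_add add_ac)

lemma L_add_left: "L (y + y') z = L y z + L y' z"
  by (simp add: L_def distrib_right tr_add add_ac)

lemma B_add: "B s (z + z') w = B s z w + B s z' w"
  by (simp add: B_def distrib_left distrib_right tr_add add_ac)

lemma L_nondegenerate:
  assumes "y \<in> V" "y \<noteq> 0"
  obtains z where "z \<in> V" "L y z = 1"
proof (cases "fst y = 0")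
  case True
  then have "snd y = 1" using assms by (auto simp: V_def zero_prod_def)
  with True show ?thesis by (intro that[of "(0, 1)"]) (auto simp: V_def L_def)
next
  case False
  then show ?thesis
    using assms by (intro that[of "(inverse (fst y), 0)"]) (auto simp: V_def L_def)
qed

text \<open>The Kerdock property: the difference of two of the forms has trivial radical. If the
  traces of \<open>s * fst u\<close> and \<open>t * fst u\<close> differ, the vector
  \<open>(0, 1)\<close> detects it. Otherwise the functional on the first coordinate is
  \<open>tr (c * y)\<close>, and \<open>inverse c\<close> is a witness because
  \<open>tr 1 = 1\<close>.\<close>

lemma B_nondegenerate:
  assumes s: "s \<in> K" and t: "t \<in> K" and "s \<noteq> t" and u: "u \<in> V" "u \<noteq> 0"
  obtains z where "z \<in> V" "B s z u + B t z u = 1"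
proof -
  define x a where "x = fst u" and "a = snd u"
  have x: "x \<in> K" and a: "a \<in> {0, 1}" using u by (auto simp: x_def a_def V_def)
  define e where "e = tr (s * x)"
  have e: "e \<in> {0, 1}" unfolding e_def by (intro tr_bit K_mult s x)
  show thesis
  proof (cases "tr (t * x) = e")
    case False
    moreover have "tr (t * x) \<in> {0, 1}" by (intro tr_bit K_mult t x)
    ultimately have "e + tr (t * x) = 1" using e by auto
    then have "B s (0, 1) u + B t (0, 1) u = 1" by (simp add: B_def x_def e_def)
    then show ?thesis by (intro that[of "(0, 1)"]) (auto simp: V_def)
  next
    case True
    \<comment> \<open>the element representing \<open>y \<mapsto> B s (y, 0) u + B t (y, 0) u\<close> through the trace form\<close>
    define c where "c = (s + t) * ((s + t) * x + e + a)"
    have c_eq: "c * y = s * y * e + t * y * e + (s * y * (s * x) + t * y * (t * x)) + s * y * a + t * y * a" for y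
    proof -
      have "s * t * x * y + s * t * x * y = 0" by simp
      then show ?thesis unfolding c_def by (simp add: algebra_simps)
    qed
    have B_eq: "B s (y, 0) u + B t (y, 0) u = tr (c * y)" for y
      using e a True unfolding c_eq
      by (simp only: tr_add tr_mult_bit) (simp add: B_def x_def a_def e_def algebra_simps)
    \<comment> \<open>If \<open>c\<close> were 0, then \<open>(s + t) * x\<close> would be the bit
      \<open>e + a\<close>. Its trace is 0 in this case and a bit is its own trace, so
      \<open>x\<close>, \<open>e\<close> and \<open>a\<close> would vanish in turn.\<close>
    have "c \<noteq> 0"
    proof
      assume "c = 0"
      with \<open>s \<noteq> t\<close> have "(s + t) * x + e + a = 0" by (simp add: c_def add_eq_0_iff_eq)
      then have *: "(s + t) * x = e + a" by (simp add: add_eq_0_iff_eq add.assoc)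
      have "tr ((s + t) * x) = 0" using True by (simp add: distrib_right tr_add e_def)
      with * have "tr (e + a) = 0" by simp
      then have "e + a = 0" using e a by auto
      with * \<open>s \<noteq> t\<close> have "x = 0" by (simp add: add_eq_0_iff_eq)
      with \<open>e + a = 0\<close> have "a = 0" by (simp add: e_def)
      with \<open>x = 0\<close> u show False by (simp add: x_def a_def prod_eq_iff)
    qed
    then have "B s (inverse c, 0) u + B t (inverse c, 0) u = 1" unfolding B_eq by simp
    moreover have "e \<in> K" "a \<in> K" using e a by auto
    then have "c \<in> K" unfolding c_def by (intro K_mult K_add s t x)
    ultimately show ?thesis by (intro that[of "(inverse c, 0)"]) (auto simp: V_def)
  qed
qed

section \<open>Mutually unbiased bases\<close>

text \<open>For fixed \<open>s\<close> the sign vectors \<open>\<phi> s y\<close> form one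
  orthogonal basis, indexed by \<open>y\<close> and not normalised.\<close>

definition \<phi> :: "'a \<Rightarrow> 'a \<times> 'a \<Rightarrow> 'a \<times> 'a \<Rightarrow> real" where
  "\<phi> s y z = chi (Q s z + L y z)"

lemma \<phi>_mult:
  assumes "s \<in> K" "t \<in> K" "y \<in> V" "y' \<in> V" "z \<in> V"
  shows "\<phi> s y z * \<phi> t y' z = chi (Q s z + Q t z + L (y + y') z)"
  unfolding \<phi>_def using assms
  by (simp only: chi_add[symmetric] bits_add Q_bit L_bit L_add_left add_ac)

text \<open>The quadratic parts cancel, and what remains is the sum of a nontrivial linear
  character.\<close>

lemma same_basis:
  assumes "s \<in> K" "y \<in> V" "y' \<in> V" "y \<noteq> y'"
  shows "(\<Sum>z\<in>V. \<phi> s y z * \<phi> s y' z) = 0"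
proof -
  have "y + y' \<noteq> 0" using assms(4) by (auto simp: prod_eq_iff add_eq_0_iff_eq)
  then obtain w where w: "w \<in> V" "L (y + y') w = 1"
    using L_nondegenerate V_add assms by metis
  have "(\<Sum>z\<in>V. \<phi> s y z * \<phi> s y' z) = (\<Sum>z\<in>V. chi (L (y + y') z))"
    using assms by (intro sum.cong refl) (simp add: \<phi>_mult)
  also have "\<dots> = 0"
  proof (rule nontrivial_character_sum[of w])
    fix z assume "z \<in> V"
    then show "chi (L (y + y') (z + w)) = chi (L (y + y') z) * chi (L (y + y') w)"
      using w(1) assms by (simp only: L_add chi_add L_bit V_add)
  qed (simp_all add: w V_add V_self)
  finally show ?thesis .
qed

text \<open>The product is the sign of a quadratic function with nondegenerate polarisation, so its
  sum is a Gauss sum with square \<open>card V\<close>.\<close>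

lemma distinct_bases:
  assumes st: "s \<in> K" "t \<in> K" "s \<noteq> t" and y: "y \<in> V" "y' \<in> V"
  shows "\<bar>\<Sum>z\<in>V. \<phi> s y z * \<phi> t y' z\<bar> = 2 ^ (h + 1)"
proof -
  define F where "F = (\<lambda>z. Q s z + Q t z + L (y + y') z)"
  have F_bit: "F z \<in> {0, 1}" if "z \<in> V" for z
    unfolding F_def using st y that by (intro bits_add Q_bit L_bit V_add)
  have F_add: "F (z + w) = F z + F w + (B s z w + B t z w)" if "z \<in> V" "w \<in> V" for z w
    unfolding F_def Q_add[OF st(1) that] Q_add[OF st(2) that] L_add by (simp add: add_ac)
  have BB_bit: "B s z w + B t z w \<in> {0, 1}" if "z \<in> V" "w \<in> V" for z w
    using st that by (intro bits_add B_bit)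
  have "(\<Sum>z\<in>V. chi (F z))\<^sup>2 = card V"
  proof (rule quadratic_Gauss_sum[where \<beta> = "\<lambda>z u. chi (B s z u + B t z u)"])
    show "chi (F 0) = 1" by (simp add: F_def Q_def L_def qtr_def)
    fix u assume u: "u \<in> V"
    { fix z assume z: "z \<in> V"
      show "chi (F (z + u)) = chi (F z) * chi (F u) * chi (B s z u + B t z u)"
        unfolding F_add[OF z u] using z u by (simp only: chi_add bits_add F_bit BB_bit) }
    assume "u \<noteq> 0"
    then obtain w where w: "w \<in> V" "B s w u + B t w u = 1"
      using B_nondegenerate st u by metis
    show "(\<Sum>z\<in>V. chi (B s z u + B t z u)) = 0"
    proof (rule nontrivial_character_sum[of w])
      fix z assume z: "z \<in> V"
      have "B s (z + w) u + B t (z + w) u = (B s z u + B t z u) + (B s w u + B t w u)"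
        by (simp add: B_add add_ac)
      then show "chi (B s (z + w) u + B t (z + w) u) = chi (B s z u + B t z u) * chi (B s w u + B t w u)"
        using z w(1) u by (simp only: chi_add BB_bit)
    qed (simp_all add: w V_add V_self)
  qed (simp_all add: V_0 V_add V_self)
  moreover have "(\<Sum>z\<in>V. \<phi> s y z * \<phi> t y' z) = (\<Sum>z\<in>V. chi (F z))"
    unfolding F_def using st y by (intro sum.cong refl \<phi>_mult)
  ultimately have "\<bar>\<Sum>z\<in>V. \<phi> s y z * \<phi> t y' z\<bar>\<^sup>2 = (2 ^ (h + 1))\<^sup>2"
    by (simp add: card_V)
  then show ?thesis by (subst (asm) power2_eq_iff_nonneg) auto
qed

end

section \<open>Families of lines from coordinates, and the maximum\<close>

text \<open>The index set \<open>Z\<close> is enumerated and the vectors are padded with zeros up to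
  dimension \<open>r\<close>. Different indices span different lines, since collinear unit vectors
  have inner product of absolute value 1.\<close>

lemma equiangular_from_coordinates:
  fixes f :: "'j \<Rightarrow> 'i \<Rightarrow> real"
  assumes J: "finite J" and Z: "finite Z" "card Z \<le> r" and "\<alpha> < 1"
    and unit: "\<And>j. j \<in> J \<Longrightarrow> (\<Sum>z\<in>Z. f j z * f j z) = 1"
    and angle: "\<And>i j. i \<in> J \<Longrightarrow> j \<in> J \<Longrightarrow> i \<noteq> j \<Longrightarrow> \<bar>\<Sum>z\<in>Z. f i z * f j z\<bar> = \<alpha>"
  obtains L where "finite L" "equiangular r \<alpha> L" "card L = card J"
proof -
  obtain e where e: "bij_betw e {0..<card Z} Z"
    using ex_bij_betw_nat_finite[OF Z(1)] by blast
  define g where "g = (\<lambda>j. vec r (\<lambda>k. if k < card Z then f j (e k) else 0))"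
  define line where "line = (\<lambda>j. {c \<cdot>\<^sub>v g j | c. True})"
  have g_dim: "g j \<in> carrier_vec r" for j by (simp add: g_def)
  have dot: "g i \<bullet> g j = (\<Sum>z\<in>Z. f i z * f j z)" for i j
  proof -
    have "g i \<bullet> g j = (\<Sum>k\<in>{0..<r}. if k \<in> {0..<card Z} then f i (e k) * f j (e k) else 0)"
      by (auto simp: g_def scalar_prod_def intro!: sum.cong)
    also have "\<dots> = (\<Sum>k\<in>{0..<card Z}. f i (e k) * f j (e k))"
      by (rule sum.mono_neutral_cong_right) (use Z(2) in auto)
    also have "\<dots> = (\<Sum>z\<in>Z. f i z * f j z)"
      by (rule sum.reindex_bij_betw[OF e])
    finally show ?thesis .
  qed
  have self: "g j \<in> line j" for j
    unfolding line_def by (intro CollectI exI[of _ 1]) simp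
  have inj: "inj_on line J"
  proof (rule inj_onI, rule ccontr)
    fix i j assume ij: "i \<in> J" "j \<in> J" "line i = line j" "i \<noteq> j"
    then obtain c where c: "g i = c \<cdot>\<^sub>v g j"
      using self[of i] by (auto simp: line_def)
    have prod: "g i \<bullet> g j = c"
      using unit[OF ij(2)] g_dim by (simp add: c dot)
    have "g i \<bullet> g i = c * (c * (g j \<bullet> g j))"
      unfolding c using g_dim[of j] by simp
    then have "c * c = 1" using unit[OF ij(1)] unit[OF ij(2)] by (simp add: dot)
    then have "\<bar>c\<bar> = 1" by (simp add: abs_square_eq_1 flip: power2_eq_square)
    then show False
      using angle[OF ij(1,2,4)] prod \<open>\<alpha> < 1\<close> by (simp add: dot)
  qed
  define v where "v = (\<lambda>l. g (inv_into J line l))"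
  have v: "v (line j) = g j" if "j \<in> J" for j
    by (simp add: v_def inv_into_f_f[OF inj that])
  have "line j \<in> lines_through_origin r" if "j \<in> J" for j
  proof -
    have "g j \<noteq> 0\<^sub>v r"
      using unit[OF that] g_dim[of j] by (auto simp flip: dot)
    then show ?thesis using g_dim[of j] by (auto simp: lines_through_origin_def line_def)
  qed
  moreover have "\<bar>v l \<bullet> v m\<bar> = \<alpha>" if "l \<in> line ` J" "m \<in> line ` J" "l \<noteq> m" for l m
  proof -
    from that(1,2) obtain i j where ij: "l = line i" "i \<in> J" "m = line j" "j \<in> J" by blast
    with that(3) have "i \<noteq> j" by blast
    with ij angle show ?thesis by (simp add: v dot)
  qed
  ultimately have "equiangular r \<alpha> (line ` J)"
    unfolding equiangular_def using unit
    by (intro conjI exI[of _ v] ballI impI) (auto simp: v dot self)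
  with J inj show thesis by (intro that[of "line ` J"]) (auto simp: card_image)
qed

text \<open>The upper bound also makes the set of cardinalities finite, and the empty family makes
  it nonempty, so \<open>Max\<close> is a genuine maximum.\<close>

lemma max_equiangular_bounds:
  assumes "0 < \<alpha>" "\<alpha> \<le> 1 / 4"
  shows "real (max_equiangular \<alpha> r) \<le> 1 + 140 / \<alpha> ^ 4 + 160 * real r"
    and "finite L \<Longrightarrow> equiangular r \<alpha> L \<Longrightarrow> card L \<le> max_equiangular \<alpha> r"
proof -
  define S where "S = {card L | L. finite L \<and> equiangular r \<alpha> L}"
  have bound: "real n \<le> 1 + 140 / \<alpha> ^ 4 + 160 * real r" if "n \<in> S" for n
    using that card_equiangular_le[OF _ _ assms] by (auto simp: S_def)
  then have "S \<subseteq> {..nat \<lfloor>1 + 140 / \<alpha> ^ 4 + 160 * real r\<rfloor>}"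
    by (intro subsetI) (simp only: atMost_iff le_nat_floor)
  then have fin: "finite S" using finite_subset by blast
  have "card ({} :: real vec set set) \<in> S"
    unfolding S_def by (intro CollectI exI[of _ "{}"]) (simp add: equiangular_def)
  then have "S \<noteq> {}" by blast
  then show "real (max_equiangular \<alpha> r) \<le> 1 + 140 / \<alpha> ^ 4 + 160 * real r"
    using bound[OF Max_in[OF fin]] by (simp add: max_equiangular_def S_def)
  show "finite L \<Longrightarrow> equiangular r \<alpha> L \<Longrightarrow> card L \<le> max_equiangular \<alpha> r"
    using Max_ge[OF fin] by (auto simp: max_equiangular_def S_def)
qed

text \<open>The coordinates are \<open>V\<close> together with one new coordinate for each basis,
  \<open>3 / 2 * D\<^sup>2\<close> in all. Before normalisation the inner products are
  \<open>D\<^sup>2 + D\<close> on the diagonal, \<open>0 + D\<close> inside a basis and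
  \<open>D\<close> or \<open>- D\<close> between bases, which gives the angle
  \<open>D / (D\<^sup>2 + D)\<close>.\<close>

lemma (in odd_binary_field) large_equiangular_family:
  fixes r :: nat
  defines "D \<equiv> 2 ^ (h + 1) :: real"
  assumes r: "3 / 2 * D\<^sup>2 \<le> real r"
  obtains L where "finite L" "equiangular r (1 / (D + 1)) L" "real (card L) = D ^ 4 / 2"
proof -
  define f :: "'a \<times> 'a \<times> 'a \<Rightarrow> 'a \<times> 'a + 'a \<Rightarrow> real" where
    "f = (\<lambda>(s, y) c. case c of
        Inl z \<Rightarrow> \<phi> s y z / sqrt (D\<^sup>2 + D)
      | Inr t \<Rightarrow> (if s = t then sqrt D else 0) / sqrt (D\<^sup>2 + D))"
  have D: "D > 0" by (simp add: D_def)
  have card_K': "real (card K) = D\<^sup>2 / 2" and card_V': "real (card V) = D\<^sup>2"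
    by (simp_all add: card_K card_V D_def power_mult_distrib flip: power_mult)
  have inner: "(\<Sum>c\<in>Sum_Type.Plus V K. f (s, y) c * f (t, y') c) =
      ((\<Sum>z\<in>V. \<phi> s y z * \<phi> t y' z) + (if s = t then D else 0)) / (D\<^sup>2 + D)"
    if "s \<in> K" for s t y y'
  proof -
    have "f (s, y) (Inl z) * f (t, y') (Inl z) = \<phi> s y z * \<phi> t y' z / (D\<^sup>2 + D)" for z
      using D by (simp add: f_def)
    moreover have "f (s, y) (Inr k) * f (t, y') (Inr k) =
        (if k = s then if s = t then D / (D\<^sup>2 + D) else 0 else 0)" for k
      using D by (simp add: f_def)
    ultimately show ?thesis
      using that by (simp add: sum.Plus add_divide_distrib flip: sum_divide_distrib)
  qed
  have "D\<^sup>2 + D = D * (D + 1)" by (simp add: power2_eq_square algebra_simps)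
  then have alpha: "1 / (D + 1) = D / (D\<^sup>2 + D)" using D by simp
  obtain L where "finite L" "equiangular r (1 / (D + 1)) L" "card L = card (K \<times> V)"
  proof (rule equiangular_from_coordinates[where J = "K \<times> V" and Z = "Sum_Type.Plus V K" and r = r
        and \<alpha> = "1 / (D + 1)" and f = f])
    have "real (card (Sum_Type.Plus V K)) \<le> real r"
      using r by (simp add: card_Plus card_K' card_V')
    then show "card (Sum_Type.Plus V K) \<le> r" by simp
    show "1 / (D + 1) < 1" using D by simp
  next
    fix j assume "j \<in> K \<times> V"
    moreover have "D\<^sup>2 + D \<noteq> 0" using D by (metis add_pos_pos less_irrefl zero_less_power)
    ultimately show "(\<Sum>z\<in>Sum_Type.Plus V K. f j z * f j z) = 1"
      by (auto simp: inner \<phi>_def card_V')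
  next
    fix i j assume ij: "i \<in> K \<times> V" "j \<in> K \<times> V" "i \<noteq> j"
    obtain s y t y' where eq: "i = (s, y)" "j = (t, y')" by (metis surj_pair)
    show "\<bar>\<Sum>z\<in>Sum_Type.Plus V K. f i z * f j z\<bar> = 1 / (D + 1)"
    proof (cases "s = t")
      case True
      with ij eq D show ?thesis by (simp add: inner same_basis alpha)
    next
      case False
      with ij eq have "\<bar>\<Sum>z\<in>V. \<phi> s y z * \<phi> t y' z\<bar> = D"
        unfolding D_def by (intro distinct_bases) auto
      with False ij eq D show ?thesis by (simp add: inner alpha)
    qed
  qed simp_all
  moreover have "real (card (K \<times> V)) = D ^ 4 / 2"
    by (simp add: card_cartesian_product card_K' card_V' numeral_eq_Suc)
  ultimately show thesis using that by metis
qed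

section \<open>The sequence of angles and the choice of constants\<close>

theorem corollary1p9:
  "\<exists>C > (0::real). \<exists>\<alpha> :: nat \<Rightarrow> real.
     (\<forall>t\<ge>1. 0 < \<alpha> t \<and> \<alpha> t < 1) \<and> \<alpha> \<longlonglongrightarrow> 0 \<and>
     (\<forall>c > (0::real). \<exists>c1 > (0::real). \<exists>c2 > (0::real). \<exists>t0 \<ge> (1::nat).
        \<forall>t \<ge> t0. \<forall>r \<ge> (1::nat).
          C / (\<alpha> t) ^ 2 \<le> real r \<longrightarrow> real r \<le> c / (\<alpha> t) ^ 4 \<longrightarrow>
          c1 / (\<alpha> t) ^ 4 \<le> real (max_equiangular (\<alpha> t) r) \<and>
          real (max_equiangular (\<alpha> t) r) \<le> c2 / (\<alpha> t) ^ 4)"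
proof -
  \<comment> \<open>\<open>D t\<close> is the square root of the order of \<open>V\<close> for
    \<open>h = t\<close>. From \<open>t = 1\<close> on, \<open>\<alpha> t\<close> is at most
    \<open>1 / 4\<close>, so \<open>t0 = 1\<close> serves for every \<open>c\<close>.\<close>
  define D where "D = (\<lambda>t::nat. 2 ^ (t + 1) :: real)"
  define \<alpha> where "\<alpha> = (\<lambda>t. 1 / (D t + 1))"
  have D: "D t \<ge> 2" for t using power_increasing[of 1 "t + 1" "2::real"] by (simp add: D_def)
  have D4: "D t \<ge> 4" if "t \<ge> 1" for t
    using power_increasing[of 2 "t + 1" "2::real"] that by (simp add: D_def)
  have \<alpha>: "0 < \<alpha> t" "\<alpha> t < 1" for t using D[of t] by (auto simp: \<alpha>_def)
  have \<alpha>4: "\<alpha> t \<le> 1 / 4" if "t \<ge> 1" for t using D4[OF that] by (auto simp: \<alpha>_def field_simps)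
  have lim: "\<alpha> \<longlonglongrightarrow> 0"
  proof (rule tendsto_sandwich[OF _ _ tendsto_const])
    show "\<forall>\<^sub>F t in sequentially. \<alpha> t \<le> (1 / 2) ^ t"
    proof (rule always_eventually, rule allI)
      fix t
      have "2 ^ t \<le> D t + 1" by (simp add: D_def)
      then have "1 / (D t + 1) \<le> 1 / 2 ^ t" by (intro divide_left_mono) (auto simp: D_def add_pos_pos)
      then show "\<alpha> t \<le> (1 / 2) ^ t" by (simp add: \<alpha>_def power_one_over)
    qed
    show "(\<lambda>t. (1 / 2 :: real) ^ t) \<longlonglongrightarrow> 0" by (rule LIMSEQ_realpow_zero) auto
  qed (use \<alpha> in \<open>auto intro: always_eventually less_imp_le\<close>)
  have lower: "1 / 32 / \<alpha> t ^ 4 \<le> real (max_equiangular (\<alpha> t) r)"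
    if "t \<ge> 1" "2 / (\<alpha> t)\<^sup>2 \<le> real r" for t r
  proof -
    have two: "(2 :: bit alg_closure) = 0"
      using to_ac_numeral[of "num.Bit0 num.One", where ?'a = bit] by simp
    interpret odd_binary_field t "{x :: bit alg_closure. x ^ 2 ^ (2 * t + 1) = x}"
      by unfold_locales (simp_all only: two card_Frobenius_fixed zero_less_Suc Suc_eq_plus1[symmetric])
    \<comment> \<open>This is why \<open>C = 2\<close> works:
      \<open>2 / (\<alpha> t)\<^sup>2\<close> is at least the number of coordinates used by the
      construction.\<close>
    have "3 / 2 * (D t)\<^sup>2 \<le> 2 * (D t + 1)\<^sup>2"
      using D[of t] by (simp add: power2_eq_square algebra_simps)
    also have "\<dots> = 2 / (\<alpha> t)\<^sup>2" by (simp add: \<alpha>_def power_divide)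
    finally have "3 / 2 * (D t)\<^sup>2 \<le> real r" using that(2) by linarith
    then obtain L where "finite L" "equiangular r (\<alpha> t) L" "real (card L) = D t ^ 4 / 2"
      using large_equiangular_family[of r] unfolding D_def \<alpha>_def by blast
    moreover from this have "card L \<le> max_equiangular (\<alpha> t) r"
      using \<alpha>(1) \<alpha>4[OF that(1)] by (intro max_equiangular_bounds)
    moreover have "1 / 32 / \<alpha> t ^ 4 \<le> D t ^ 4 / 2"
    proof -
      \<comment> \<open>The factor 16 lost here and the 2 in \<open>D t ^ 4 / 2\<close> give
        \<open>1 / 32\<close>.\<close>
      have "(D t + 1) ^ 4 \<le> (2 * D t) ^ 4" using D[of t] by (intro power_mono) auto
      then show ?thesis by (simp add: \<alpha>_def power_divide power_mult_distrib)
    qed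
    ultimately show ?thesis by linarith
  qed
  have upper: "real (max_equiangular (\<alpha> t) r) \<le> (141 + 160 * c) / \<alpha> t ^ 4"
    if "t \<ge> 1" "real r \<le> c / \<alpha> t ^ 4" for t r c
  proof -
    have "\<alpha> t ^ 4 \<le> 1" using \<alpha>[of t] by (simp add: power_le_one)
    then have "1 \<le> 1 / \<alpha> t ^ 4" using \<alpha>[of t] by simp
    moreover have "real (max_equiangular (\<alpha> t) r) \<le> 1 + 140 / \<alpha> t ^ 4 + 160 * real r"
      using \<alpha>(1) \<alpha>4[OF that(1)] by (rule max_equiangular_bounds)
    moreover have "(141 + 160 * c) / \<alpha> t ^ 4 = 1 / \<alpha> t ^ 4 + 140 / \<alpha> t ^ 4 + 160 * (c / \<alpha> t ^ 4)"
      by (simp add: add_divide_distrib)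
    ultimately show ?thesis using that(2) by linarith
  qed
  have bounds: "\<exists>c1>0. \<exists>c2>0. \<exists>t0\<ge>1. \<forall>t\<ge>t0. \<forall>r\<ge>1. 2 / (\<alpha> t)\<^sup>2 \<le> real r \<longrightarrow> real r \<le> c / \<alpha> t ^ 4 \<longrightarrow>
      c1 / \<alpha> t ^ 4 \<le> real (max_equiangular (\<alpha> t) r) \<and>
      real (max_equiangular (\<alpha> t) r) \<le> c2 / \<alpha> t ^ 4" if "c > 0" for c
  proof (rule exI[of _ "1 / 32"], rule conjI, simp, rule exI[of _ "141 + 160 * c"], intro conjI)
    show "0 < 141 + 160 * c" using that by simp
    show "\<exists>t0\<ge>1. \<forall>t\<ge>t0. \<forall>r\<ge>1. 2 / (\<alpha> t)\<^sup>2 \<le> real r \<longrightarrow> real r \<le> c / \<alpha> t ^ 4 \<longrightarrow>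
        1 / 32 / \<alpha> t ^ 4 \<le> real (max_equiangular (\<alpha> t) r) \<and>
        real (max_equiangular (\<alpha> t) r) \<le> (141 + 160 * c) / \<alpha> t ^ 4"
      by (intro exI[of _ "1::nat"] conjI allI impI lower upper order.refl)
  qed
  show ?thesis
    by (rule exI[of _ 2], rule conjI, simp, rule exI[of _ \<alpha>], intro conjI allI impI \<alpha> lim bounds)
qed

end
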